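(* Let $G$ be a connected graph with $n\geq 12$ vertices. If $\frac{1}{2}\leq \alpha < 1$, then $$S_{2}(A_{\alpha}(G))\geq S_{2}(A_{\alpha}(P_n)),$$ with equality if and only if $G=P_n$.
   Context: All graphs are simple and undirected. $P_n$ is the path on $n$ vertices. $A_{\alpha}(G)=\alpha D(G)+(1-\alpha)A(G)$, where $A(G)$ is the adjacency matrix and $D(G)$ the diagonal degree matrix. For a real symmetric matrix $M$ with eigenvalues $\lambda_1(M)\geq\cdots\geq\lambda_n(M)$, $S_2(M)=\lambda_1(M)+\lambda_2(M)$. *)

theory Defs
  imports "Jordan_Normal_Form.Matrix" "Jordan_Normal_Form.Char_Poly"
begin

definition simple_graph :: "nat \<Rightarrow> (nat \<Rightarrow> nat \<Rightarrow> bool) \<Rightarrow> bool" where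
  "simple_graph n E \<longleftrightarrow> (\<forall>i<n. \<forall>j<n. E i j \<longleftrightarrow> E j i) \<and> (\<forall>i<n. \<not> E i i)"

definition graph_connected :: "nat \<Rightarrow> (nat \<Rightarrow> nat \<Rightarrow> bool) \<Rightarrow> bool" where
  "graph_connected n E \<longleftrightarrow>
     (\<forall>i<n. \<forall>j<n. (\<lambda>u v. u < n \<and> v < n \<and> E u v)\<^sup>*\<^sup>* i j)"

definition degree :: "nat \<Rightarrow> (nat \<Rightarrow> nat \<Rightarrow> bool) \<Rightarrow> nat \<Rightarrow> nat" where
  "degree n E i = card {j. j < n \<and> E i j}"

definition path_adj :: "nat \<Rightarrow> nat \<Rightarrow> bool" where
  "path_adj i j \<longleftrightarrow> i + 1 = j \<or> j + 1 = i"

definition graph_iso :: "nat \<Rightarrow> (nat \<Rightarrow> nat \<Rightarrow> bool) \<Rightarrow> (nat \<Rightarrow> nat \<Rightarrow> bool) \<Rightarrow> bool" where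
  "graph_iso n E F \<longleftrightarrow>
     (\<exists>f. bij_betw f {0..<n} {0..<n} \<and> (\<forall>i<n. \<forall>j<n. E i j \<longleftrightarrow> F (f i) (f j)))"

definition adj_matrix :: "nat \<Rightarrow> (nat \<Rightarrow> nat \<Rightarrow> bool) \<Rightarrow> real mat" where
  "adj_matrix n E = mat n n (\<lambda>(i,j). if E i j then 1 else 0)"

definition deg_matrix :: "nat \<Rightarrow> (nat \<Rightarrow> nat \<Rightarrow> bool) \<Rightarrow> real mat" where
  "deg_matrix n E = mat n n (\<lambda>(i,j). if i = j then real (degree n E i) else 0)"

definition A_alpha :: "real \<Rightarrow> nat \<Rightarrow> (nat \<Rightarrow> nat \<Rightarrow> bool) \<Rightarrow> real mat" where
  "A_alpha \<alpha> n E = \<alpha> \<cdot>\<^sub>m deg_matrix n E + (1 - \<alpha>) \<cdot>\<^sub>m adj_matrix n E"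

text \<open>Eigenvalues (with multiplicity) of a real matrix whose characteristic polynomial
  splits over the reals (e.g. a real symmetric matrix), in non-increasing order.\<close>
definition eigenvalues_desc :: "real mat \<Rightarrow> real list" where
  "eigenvalues_desc M = (THE xs. length xs = dim_row M \<and> sorted_wrt (\<ge>) xs \<and>
      char_poly M = (\<Prod>x\<leftarrow>xs. [:- x, 1:]))"

definition S2 :: "real mat \<Rightarrow> real" where
  "S2 M = eigenvalues_desc M ! 0 + eigenvalues_desc M ! 1"

end

(*
  At \<alpha> \<ge> 1/2 every edge contributes a nonnegative quadratic form
  (1 - \<alpha>)(a + b)^2 + (2\<alpha> - 1)(a^2 + b^2), so by Ky Fan's principle (S_2 is the maximum of
  q x + q y over orthonormal pairs) S_2 is monotone under graph embeddings. For the path,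
  2|x|^2 - q x is a positive definite sum of squares, hence both leading eigenvalues are below 2
  and S_2 < 4.

  A longest path in a connected graph is Hamiltonian or shows a vertex of degree at least 3.
  In the Hamiltonian case with an additional edge there are at least n edges, so the constant
  vector has Rayleigh quotient at least 2 > \<lambda>_1(P_n); pairing it with a vector orthogonal to it in the
  span of the two leading eigenvectors of P_n gives strict inequality. Otherwise grow the claw
  leaf by leaf: by the time it has 12 vertices it contains one of 16 trees with S_2 \<ge> 4,
  each certified by two orthogonal integer vectors.
*)

theory Submission
  imports Defs "HOL-Analysis.Function_Topology"
begin

section \<open>Spectral theorem for real symmetric matrices\<close>

text \<open>For each \<alpha> in [1/2, 1) the value \<open>S2\<close> of the path tends to 4 as n
  grows, so 4 is the least bound independent of n that every path stays below. This is what allows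
  finitely many fixed trees to settle the claw case for all n and \<alpha> at once; no eigenvalue of
  a path is ever computed. The 12 comes from the spider with legs of 4, 3 and 3 edges: it has 11
  vertices and contains none of the certified trees, while every tree obtained from it by adding a
  leaf contains one. All other trees met on the way are smaller, so growth is forced into a
  certified tree once 12 vertices are available. Explicit embeddings record the growth, so no
  isomorphism test for trees is required.\<close>

definition dot :: "nat \<Rightarrow> (nat \<Rightarrow> real) \<Rightarrow> (nat \<Rightarrow> real) \<Rightarrow> real" where
  "dot n x y = (\<Sum>i<n. x i * y i)"

text \<open>Vectors and matrices are functions of which only the indices below \<open>n\<close>
  matter; carriers appear only where determinants and characteristic polynomials are needed.\<close>

definition mat_app :: "nat \<Rightarrow> (nat \<Rightarrow> nat \<Rightarrow> real) \<Rightarrow> (nat \<Rightarrow> real) \<Rightarrow> nat \<Rightarrow> real" where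
  "mat_app n M x i = (\<Sum>j<n. M i j * x j)"

definition quad :: "nat \<Rightarrow> (nat \<Rightarrow> nat \<Rightarrow> real) \<Rightarrow> (nat \<Rightarrow> real) \<Rightarrow> real" where
  "quad n M x = dot n x (mat_app n M x)"

lemma dot_commute: "dot n x y = dot n y x"
  by (simp add: dot_def mult.commute)

lemma dot_lincomb_left: "dot n (\<lambda>i. a * x i + b * y i) z = a * dot n x z + b * dot n y z"
  by (simp add: dot_def sum.distrib sum_distrib_left algebra_simps)

lemma dot_lincomb_right: "dot n z (\<lambda>i. a * x i + b * y i) = a * dot n z x + b * dot n z y"
  by (simp add: dot_def sum.distrib sum_distrib_left algebra_simps)

lemma dot_cong: "(\<And>i. i < n \<Longrightarrow> x i = x' i) \<Longrightarrow> (\<And>i. i < n \<Longrightarrow> y i = y' i) \<Longrightarrow> dot n x y = dot n x' y'"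
  by (simp add: dot_def)

lemma dot_self_nonneg: "dot n x x \<ge> 0"
  by (simp add: dot_def sum_nonneg)

lemma dot_self_eq_0_iff: "dot n x x = 0 \<longleftrightarrow> (\<forall>i<n. x i = 0)"
  by (auto simp: dot_def sum_nonneg_eq_0_iff)

lemma mat_app_lincomb: "mat_app n M (\<lambda>i. a * x i + b * y i) = (\<lambda>i. a * mat_app n M x i + b * mat_app n M y i)"
  by (simp add: mat_app_def fun_eq_iff sum.distrib sum_distrib_left algebra_simps)

lemma dot_mat_app_symmetric:
  assumes "\<And>i j. i < n \<Longrightarrow> j < n \<Longrightarrow> M i j = M j i"
  shows "dot n x (mat_app n M y) = dot n (mat_app n M x) y"
proof -
  have "dot n x (mat_app n M y) = (\<Sum>i<n. \<Sum>j<n. x i * M i j * y j)"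
    by (simp add: dot_def mat_app_def sum_distrib_left mult.assoc)
  also have "\<dots> = (\<Sum>j<n. \<Sum>i<n. x i * M i j * y j)" by (rule sum.swap)
  also have "\<dots> = (\<Sum>j<n. \<Sum>i<n. M j i * x i * y j)"
    by (intro sum.cong refl) (simp add: assms mult.commute)
  also have "\<dots> = dot n (mat_app n M x) y"
    by (simp add: dot_def mat_app_def sum_distrib_right)
  finally show ?thesis .
qed

lemma quad_lincomb:
  assumes "\<And>i j. i < n \<Longrightarrow> j < n \<Longrightarrow> M i j = M j i"
  shows "quad n M (\<lambda>i. a * x i + b * y i)
    = a\<^sup>2 * quad n M x + 2 * a * b * dot n x (mat_app n M y) + b\<^sup>2 * quad n M y"
proof -
  have "dot n y (mat_app n M x) = dot n x (mat_app n M y)"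
    using dot_mat_app_symmetric[of n M x y, OF assms] by (simp add: dot_commute)
  then show ?thesis
    by (simp add: quad_def mat_app_lincomb dot_lincomb_left dot_lincomb_right algebra_simps power2_eq_square)
qed

lemma quad_scale: "quad n M (\<lambda>i. c * x i) = c\<^sup>2 * quad n M x"
  by (simp add: quad_def dot_def mat_app_def sum_distrib_left power2_eq_square algebra_simps)

lemma dot_scale: "dot n (\<lambda>i. c * x i) (\<lambda>i. d * y i) = c * d * dot n x y"
  by (simp add: dot_def sum_distrib_left algebra_simps)

lemma quad_cong: "(\<And>i. i < n \<Longrightarrow> x i = y i) \<Longrightarrow> quad n M x = quad n M y"
  by (simp add: quad_def dot_def mat_app_def)

section \<open>Maximising a quadratic form under orthogonality constraints\<close>

text \<open>The \<open>k\<close> conditions, padded with zero rows, form a square matrix whose last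
  row vanishes, so it is singular and any nonzero kernel vector serves.\<close>

lemma exists_orthogonal_nonzero:
  assumes "k < n"
  shows "\<exists>x. (\<forall>j<k. dot n (u j) x = 0) \<and> (\<exists>i<n. x i \<noteq> 0)"
proof -
  define A where "A = mat n n (\<lambda>(i, j). if i < k then u i j else (0::real))"
  have A: "A \<in> carrier_mat n n" by (simp add: A_def)
  have "det A = 0"
  proof -
    have "transpose_mat A *\<^sub>v unit_vec n (n - 1) = 0\<^sub>v n"
      using assms by (intro eq_vecI) (auto simp: A_def)
    moreover have "unit_vec n (n - 1) \<noteq> (0\<^sub>v n :: real vec)"
      using assms by simp
    ultimately have "det (transpose_mat A) = 0"
      using det_0_iff_vec_prod_zero[of "transpose_mat A" n] A
      by (metis transpose_carrier_mat unit_vec_carrier)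
    then show ?thesis using det_transpose[OF A] by simp
  qed
  then obtain v where v: "v \<in> carrier_vec n" "v \<noteq> 0\<^sub>v n" "A *\<^sub>v v = 0\<^sub>v n"
    using det_0_iff_vec_prod_zero[OF A] by blast
  have "dot n (u j) (\<lambda>i. v $ i) = 0" if "j < k" for j
  proof -
    have "(A *\<^sub>v v) $ j = dot n (u j) (\<lambda>i. v $ i)"
      using that assms v(1)
      by (auto simp: A_def dot_def scalar_prod_def atLeast0LessThan intro!: sum.cong)
    then show ?thesis using v(3) that assms by simp
  qed
  moreover have "\<exists>i<n. v $ i \<noteq> 0"
    using v(1,2) by (metis carrier_vecD eq_vecI index_zero_vec(1,2))
  ultimately show ?thesis by blast
qed

text \<open>Compactness of the unit sphere in the orthogonal complement yields the maximum. The
  bound is homogeneous so that it applies to any \<open>z\<close> without normalising.\<close>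

lemma exists_constrained_maximiser:
  assumes "k < n"
  shows "\<exists>x. dot n x x = 1 \<and> (\<forall>j<k. dot n (u j) x = 0) \<and>
    (\<forall>z. (\<forall>j<k. dot n (u j) z = 0) \<longrightarrow> quad n M z \<le> quad n M x * dot n z z)"
proof -
  \<comment> \<open>The sphere condition leaves the coordinates from \<open>n\<close> on free;
    fixing these to 0 and boxing the others in [-1, 1] gives a product of compact sets.\<close>
  define B :: "(nat \<Rightarrow> real) set" where "B = PiE UNIV (\<lambda>i. if i < n then {-1..1} else {0})"
  define S where "S = B \<inter> {x. dot n x x = 1} \<inter> (\<Inter>j\<in>{..<k}. {x. dot n (u j) x = 0})"
  have "compact B"
    unfolding B_def compactin_euclidean_iff[symmetric] euclidean_product_topology[symmetric]
    by (simp add: compactin_PiE compactin_euclidean_iff)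
  have coord: "continuous_on UNIV (\<lambda>x::nat \<Rightarrow> real. x i)" for i
    by simp
  have cont_dot: "continuous_on UNIV (\<lambda>x. dot n (f x) (g x))"
    if "\<And>i. continuous_on UNIV (\<lambda>x. f x i)" "\<And>i. continuous_on UNIV (\<lambda>x. g x i)"
    for f g :: "(nat \<Rightarrow> real) \<Rightarrow> nat \<Rightarrow> real"
    unfolding dot_def by (intro continuous_intros that)
  have cont_quad: "continuous_on UNIV (\<lambda>x. quad n M x)"
    unfolding quad_def mat_app_def by (intro cont_dot continuous_intros coord)
  have "closed {x. dot n x x = 1}"
    by (intro closed_Collect_eq cont_dot coord continuous_intros)
  moreover have "closed {x. dot n (u j) x = 0}" for j
    by (intro closed_Collect_eq cont_dot coord continuous_intros)
  ultimately have "compact S"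
    unfolding S_def using \<open>compact B\<close> by (intro compact_Int_closed closed_INT) auto
  \<comment> \<open>Truncating \<open>z\<close> at \<open>n\<close> changes no inner product and
    puts the rescaled vector into \<open>S\<close>; its coordinates lie in the box since their
    squares sum to 1.\<close>
  have normalise: "\<exists>c. c > 0 \<and> c\<^sup>2 * dot n z z = 1 \<and> (\<lambda>i. c * (if i < n then z i else 0)) \<in> S"
    if z: "\<forall>j<k. dot n (u j) z = 0" "dot n z z \<noteq> 0" for z
  proof -
    define c where "c = 1 / sqrt (dot n z z)"
    have pos: "dot n z z > 0" using z(2) dot_self_nonneg[of n z] by linarith
    then have c: "c > 0" "c\<^sup>2 * dot n z z = 1" by (auto simp: c_def power_divide)
    let ?w = "\<lambda>i. c * (if i < n then z i else 0)"
    have ww: "dot n ?w ?w = 1"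
      using c(2) by (simp add: dot_def sum_distrib_left power2_eq_square algebra_simps)
    have "\<bar>?w i\<bar> \<le> 1" if "i < n" for i
    proof -
      have "(?w i)\<^sup>2 \<le> (\<Sum>i<n. (?w i)\<^sup>2)"
        using that by (intro member_le_sum) auto
      also have "\<dots> = 1" using ww by (simp add: dot_def power2_eq_square)
      finally show ?thesis by (simp add: abs_square_le_1)
    qed
    then have "?w \<in> B" by (auto simp: B_def abs_le_iff)
    moreover have "dot n (u j) ?w = 0" if "j < k" for j
    proof -
      have "dot n (u j) ?w = c * dot n (u j) z"
        by (simp add: dot_def sum_distrib_left algebra_simps)
      then show ?thesis using z(1) that by simp
    qed
    ultimately have "?w \<in> S" using ww by (simp add: S_def)
    then show ?thesis using c by blast
  qed
  obtain z where z: "\<forall>j<k. dot n (u j) z = 0" "dot n z z \<noteq> 0"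
    using exists_orthogonal_nonzero[OF assms, of u] dot_self_eq_0_iff by metis
  then have "S \<noteq> {}" using normalise by blast
  then obtain x where x: "x \<in> S" "\<forall>y\<in>S. quad n M y \<le> quad n M x"
    using continuous_attains_sup[OF \<open>compact S\<close>] cont_quad
    by (metis continuous_on_subset subset_UNIV)
  have "quad n M z \<le> quad n M x * dot n z z" if z: "\<forall>j<k. dot n (u j) z = 0" for z
  proof (cases "dot n z z = 0")
    case True
    then have "quad n M z = 0" unfolding dot_self_eq_0_iff by (simp add: quad_def dot_def)
    then show ?thesis using True by simp
  next
    case False
    then obtain c where c: "c > 0" "c\<^sup>2 * dot n z z = 1" "(\<lambda>i. c * (if i < n then z i else 0)) \<in> S"
      using normalise z by blast
    have "quad n M (\<lambda>i. c * (if i < n then z i else 0)) = c\<^sup>2 * quad n M z"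
      unfolding quad_scale by (simp cong: quad_cong)
    then have "c\<^sup>2 * quad n M z \<le> quad n M x" using x(2) c(3) by metis
    then have "c\<^sup>2 * quad n M z \<le> c\<^sup>2 * (quad n M x * dot n z z)"
      using c(2) by (metis mult.commute mult.assoc mult_1)
    then show ?thesis using c(1) by (simp add: mult_le_cancel_left)
  qed
  then show ?thesis using x(1) by (auto simp: S_def)
qed

text \<open>For small t the linear term outweighs the quadratic one, so it must vanish.\<close>

lemma linear_coeff_eq_0:
  fixes a b :: real
  assumes "\<And>t. 2 * t * a \<le> t\<^sup>2 * b"
  shows "a = 0"
proof (rule ccontr)
  assume "a \<noteq> 0"
  \<comment> \<open>Has the sign of \<open>a\<close> and makes
    \<open>s\<^sup>2 * (\<bar>b\<bar> + 1)\<close> equal to \<open>s * a\<close>; the 1 keeps the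
    denominator positive.\<close>
  define s where "s = a / (\<bar>b\<bar> + 1)"
  have "2 * s * a \<le> s\<^sup>2 * b" by (rule assms)
  also have "\<dots> \<le> s\<^sup>2 * (\<bar>b\<bar> + 1)" by (intro mult_left_mono) auto
  also have "\<dots> = s * a" by (simp add: s_def power2_eq_square)
  finally have "s * a \<le> 0" by linarith
  moreover have "s * a = a\<^sup>2 / (\<bar>b\<bar> + 1)" by (simp add: s_def power2_eq_square)
  moreover have "\<dots> > 0" using \<open>a \<noteq> 0\<close> by (intro divide_pos_pos) auto
  ultimately show False by linarith
qed

text \<open>First-order condition: the residual \<open>w\<close> of the eigenvalue equation is
  itself an admissible direction, because symmetry keeps the complement of the eigenvectors
  invariant. Perturbing \<open>x\<close> along \<open>w\<close> forces the derivative, a multiple of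
  \<open>dot n w w\<close>, to vanish.\<close>

lemma constrained_maximiser_eigenvector:
  assumes sym: "\<And>i j. i < n \<Longrightarrow> j < n \<Longrightarrow> M i j = M j i"
    and eig: "\<And>j i. j < k \<Longrightarrow> i < n \<Longrightarrow> mat_app n M (u j) i = \<mu> j * u j i"
    and x: "dot n x x = 1" "\<And>j. j < k \<Longrightarrow> dot n (u j) x = 0"
    and max: "\<And>z. (\<forall>j<k. dot n (u j) z = 0) \<Longrightarrow> quad n M z \<le> quad n M x * dot n z z"
    and i: "i < n"
  shows "mat_app n M x i = quad n M x * x i"
proof -
  define l where "l = quad n M x"
  define w where "w = (\<lambda>i. 1 * mat_app n M x i + (- l) * x i)"
  have orth: "dot n (u j) w = 0" if "j < k" for j
  proof -
    have "dot n (u j) (mat_app n M x) = dot n (mat_app n M (u j)) x"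
      by (rule dot_mat_app_symmetric[of n M, OF sym])
    also have "\<dots> = dot n (\<lambda>i. \<mu> j * u j i) x"
      by (intro dot_cong eig that refl)
    also have "\<dots> = 0"
      using dot_scale[of n "\<mu> j" "u j" 1 x] x(2)[OF that] by simp
    finally show ?thesis
      using x(2)[OF that] unfolding w_def dot_lincomb_right by simp
  qed
  have "2 * t * (dot n x (mat_app n M w) - l * dot n x w) \<le> t\<^sup>2 * (l * dot n w w - quad n M w)" for t
  proof -
    have "\<forall>j<k. dot n (u j) (\<lambda>i. 1 * x i + t * w i) = 0"
      unfolding dot_lincomb_right by (simp add: orth x(2))
    then have "quad n M (\<lambda>i. 1 * x i + t * w i) \<le> l * dot n (\<lambda>i. 1 * x i + t * w i) (\<lambda>i. 1 * x i + t * w i)"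
      unfolding l_def by (rule max)
    moreover have "quad n M (\<lambda>i. 1 * x i + t * w i)
      = l + 2 * t * dot n x (mat_app n M w) + t\<^sup>2 * quad n M w"
      using quad_lincomb[of n M 1 x t w, OF sym] by (simp add: l_def)
    moreover have "dot n (\<lambda>i. 1 * x i + t * w i) (\<lambda>i. 1 * x i + t * w i)
      = 1 + 2 * t * dot n x w + t\<^sup>2 * dot n w w"
      unfolding dot_lincomb_left dot_lincomb_right
      by (simp add: x(1) dot_commute[of n w x] algebra_simps power2_eq_square)
    ultimately show ?thesis by (simp add: algebra_simps)
  qed
  then have "dot n x (mat_app n M w) - l * dot n x w = 0" by (rule linear_coeff_eq_0)
  moreover have "dot n x (mat_app n M w) = dot n (mat_app n M x) w"
    by (rule dot_mat_app_symmetric[of n M, OF sym])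
  ultimately have "dot n w w = 0"
    by (subst (1) w_def, unfold dot_lincomb_left) simp
  then show ?thesis using i by (simp add: dot_self_eq_0_iff w_def l_def)
qed

text \<open>Each new vector is a maximiser on the complement of the earlier ones, so the last clause
  comes with the construction; it later yields the order of the eigenvalues and Ky Fan's
  bound.\<close>

lemma spectral_theorem:
  assumes sym: "\<And>i j. i < n \<Longrightarrow> j < n \<Longrightarrow> M i j = M j i" and "k \<le> n"
  shows "\<exists>u \<mu>. (\<forall>i<k. \<forall>j<k. dot n (u i) (u j) = (if i = j then 1 else 0)) \<and>
    (\<forall>j<k. \<forall>i<n. mat_app n M (u j) i = \<mu> j * u j i) \<and>
    (\<forall>j<k. \<forall>z. (\<forall>i<j. dot n (u i) z = 0) \<longrightarrow> quad n M z \<le> \<mu> j * dot n z z)"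
  using \<open>k \<le> n\<close>
proof (induction k)
  case 0
  then show ?case by simp
next
  case (Suc k)
  then obtain u \<mu> where
    orth: "\<And>i j. i < k \<Longrightarrow> j < k \<Longrightarrow> dot n (u i) (u j) = (if i = j then 1 else 0)" and
    eig: "\<And>j i. j < k \<Longrightarrow> i < n \<Longrightarrow> mat_app n M (u j) i = \<mu> j * u j i" and
    ub: "\<And>j z. j < k \<Longrightarrow> (\<forall>i<j. dot n (u i) z = 0) \<Longrightarrow> quad n M z \<le> \<mu> j * dot n z z"
    by (metis Suc_leD)
  obtain x where x: "dot n x x = 1" "\<And>j. j < k \<Longrightarrow> dot n (u j) x = 0"
    "\<And>z. (\<forall>j<k. dot n (u j) z = 0) \<Longrightarrow> quad n M z \<le> quad n M x * dot n z z"
    using exists_constrained_maximiser[of k n u M] Suc.prems by auto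
  have eigx: "mat_app n M x i = quad n M x * x i" if "i < n" for i
    by (rule constrained_maximiser_eigenvector[OF sym eig x that])
  have xu: "dot n x (u j) = 0" if "j < k" for j
    using x(2)[OF that] by (simp add: dot_commute)
  define v where "v = u(k := x)"
  define l where "l = \<mu>(k := quad n M x)"
  have v: "v k = x" "\<And>j. j < k \<Longrightarrow> v j = u j" and l: "l k = quad n M x" "\<And>j. j < k \<Longrightarrow> l j = \<mu> j"
    by (simp_all add: v_def l_def)
  have "dot n (v i) (v j) = (if i = j then 1 else 0)" if "i < Suc k" "j < Suc k" for i j
    using that by (cases "i = k"; cases "j = k") (simp_all add: v orth x(1,2) xu)
  moreover have "mat_app n M (v j) i = l j * v j i" if "j < Suc k" "i < n" for j i
    using that by (cases "j = k") (simp_all add: v l eig eigx)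
  moreover have "quad n M z \<le> l j * dot n z z" if "j < Suc k" "\<forall>i<j. dot n (v i) z = 0" for j z
    using that ub[of j z] x(3)[of z] by (cases "j = k") (simp_all add: v l)
  ultimately show ?case by blast
qed

lemma quad_eigenvector:
  assumes "\<And>i. i < n \<Longrightarrow> mat_app n M u i = l * u i"
  shows "quad n M u = l * dot n u u"
proof -
  have "quad n M u = dot n u (\<lambda>i. l * u i)"
    unfolding quad_def by (intro dot_cong assms refl)
  then show ?thesis using dot_scale[of n 1 u l u] by simp
qed

section \<open>Eigenvalue lists from the characteristic polynomial\<close>

text \<open>With the eigenvectors as columns, \<open>P\<close> is orthogonal and the matrix is
  similar to the diagonal matrix of the \<open>\<mu> j\<close>, so multiplicities are right.\<close>

lemma char_poly_eigenbasis:
  assumes orth: "\<And>i j. i < n \<Longrightarrow> j < n \<Longrightarrow> dot n (u i) (u j) = (if i = j then 1 else 0)"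
    and eig: "\<And>j i. j < n \<Longrightarrow> i < n \<Longrightarrow> mat_app n M (u j) i = \<mu> j * u j i"
  shows "char_poly (mat n n (\<lambda>(i, j). M i j)) = (\<Prod>x\<leftarrow>map \<mu> [0..<n]. [:- x, 1:])"
proof -
  let ?A = "mat n n (\<lambda>(i, j). M i j)"
  define P where "P = mat n n (\<lambda>(i, j). u j i)"
  define D where "D = mat n n (\<lambda>(i, j). if i = j then \<mu> i else 0)"
  have carrier: "?A \<in> carrier_mat n n" "P \<in> carrier_mat n n" "D \<in> carrier_mat n n"
    by (auto simp: P_def D_def)
  have left_inv: "transpose_mat P * P = 1\<^sub>m n"
    using orth by (intro eq_matI) (auto simp: P_def scalar_prod_def dot_def atLeast0LessThan)
  then have right_inv: "P * transpose_mat P = 1\<^sub>m n"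
    using mat_mult_left_right_inverse carrier(2) by (metis transpose_carrier_mat)
  have "?A * P = P * D"
  proof (rule eq_matI)
    fix i j assume "i < dim_row (P * D)" "j < dim_col (P * D)"
    then have ij: "i < n" "j < n" by (auto simp: P_def D_def)
    have "(?A * P) $$ (i, j) = mat_app n M (u j) i"
      using ij by (simp add: P_def scalar_prod_def mat_app_def atLeast0LessThan)
    moreover have "(P * D) $$ (i, j) = (\<Sum>k<n. u k i * (if k = j then \<mu> k else 0))"
      using ij by (simp add: P_def D_def scalar_prod_def atLeast0LessThan)
    then have "(P * D) $$ (i, j) = \<mu> j * u j i"
      using ij by (simp add: if_distrib cong: if_cong)
    ultimately show "(?A * P) $$ (i, j) = (P * D) $$ (i, j)"
      using eig ij by simp
  qed (auto simp: P_def D_def)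
  then have "P * D * transpose_mat P = ?A * (P * transpose_mat P)"
    using carrier by (metis assoc_mult_mat transpose_carrier_mat)
  then have "?A = P * D * transpose_mat P"
    using right_inv carrier(1) by simp
  then have "similar_mat ?A D"
    using carrier left_inv right_inv by (intro similar_matI[of _ _ P "transpose_mat P" n]) auto
  then have "char_poly ?A = char_poly D" by (rule char_poly_similar)
  also have "\<dots> = (\<Prod>x\<leftarrow>diag_mat D. [:- x, 1:])"
    by (rule char_poly_upper_triangular[OF carrier(3)]) (auto simp: D_def)
  also have "diag_mat D = map \<mu> [0..<n]"
    by (auto simp: diag_mat_def D_def)
  finally show ?thesis .
qed

text \<open>This makes the \<open>THE\<close> in \<open>eigenvalues_desc\<close> well defined: both
  heads are the largest root, and the common linear factor cancels.\<close>

lemma sorted_roots_unique: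
  fixes xs ys :: "real list"
  assumes "sorted_wrt (\<ge>) xs" "sorted_wrt (\<ge>) ys" "length xs = length ys"
    and "(\<Prod>x\<leftarrow>xs. [:- x, 1:]) = (\<Prod>x\<leftarrow>ys. [:- x, 1:])"
  shows "xs = ys"
  using assms
proof (induction xs arbitrary: ys)
  case Nil
  then show ?case by simp
next
  case (Cons x xs)
  then obtain y ys' where ys: "ys = y # ys'" by (cases ys) auto
  have roots: "poly (\<Prod>x\<leftarrow>zs. [:- x, 1:]) a = 0 \<longleftrightarrow> a \<in> set zs" for zs and a :: real
    by (induction zs) auto
  have "a \<in> set (x # xs) \<longleftrightarrow> a \<in> set ys" for a
    by (simp only: roots[symmetric] Cons.prems(4))
  then have "set (x # xs) = set (y # ys')" using ys by blast
  then have "x \<in> set (y # ys')" "y \<in> set (x # xs)" by auto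
  then have "x \<le> y" "y \<le> x" using Cons.prems(1,2) ys by auto
  then have "x = y" by (rule antisym)
  moreover have "(\<Prod>x\<leftarrow>xs. [:- x, 1:]) = (\<Prod>x\<leftarrow>ys'. [:- x, 1:])"
    using Cons.prems(4) ys \<open>x = y\<close> by (simp del: mult_pCons_left mult_pCons_right)
  ultimately show ?case using Cons ys by simp
qed

lemma eigenvalues_desc_eqI:
  assumes "length xs = dim_row A" "sorted_wrt (\<ge>) xs" "char_poly A = (\<Prod>x\<leftarrow>xs. [:- x, 1:])"
  shows "eigenvalues_desc A = xs"
  unfolding eigenvalues_desc_def
proof (rule the_equality)
  fix ys assume "length ys = dim_row A \<and> sorted_wrt (\<ge>) ys \<and> char_poly A = (\<Prod>x\<leftarrow>ys. [:- x, 1:])"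
  then show "ys = xs" using assms by (intro sorted_roots_unique) auto
qed (use assms in auto)

text \<open>Here \<open>S2\<close> passes from roots of the characteristic polynomial to variational
  data; every later bound on it rests on these clauses.\<close>

lemma S2_eigenvectors:
  assumes "n \<ge> 2" and sym: "\<And>i j. i < n \<Longrightarrow> j < n \<Longrightarrow> M i j = M j i"
  shows "\<exists>u0 u1 \<mu>0 \<mu>1. S2 (mat n n (\<lambda>(i, j). M i j)) = \<mu>0 + \<mu>1 \<and> \<mu>1 \<le> \<mu>0 \<and>
    dot n u0 u0 = 1 \<and> dot n u1 u1 = 1 \<and> dot n u0 u1 = 0 \<and>
    (\<forall>i<n. mat_app n M u0 i = \<mu>0 * u0 i) \<and> (\<forall>i<n. mat_app n M u1 i = \<mu>1 * u1 i) \<and>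
    (\<forall>z. quad n M z \<le> \<mu>0 * dot n z z) \<and> (\<forall>z. dot n u0 z = 0 \<longrightarrow> quad n M z \<le> \<mu>1 * dot n z z)"
proof -
  obtain u \<mu> where
    orth: "\<And>i j. i < n \<Longrightarrow> j < n \<Longrightarrow> dot n (u i) (u j) = (if i = j then 1 else 0)" and
    eig: "\<And>j i. j < n \<Longrightarrow> i < n \<Longrightarrow> mat_app n M (u j) i = \<mu> j * u j i" and
    ub: "\<And>j z. j < n \<Longrightarrow> (\<forall>i<j. dot n (u i) z = 0) \<Longrightarrow> quad n M z \<le> \<mu> j * dot n z z"
    using spectral_theorem[of n M n, OF sym order_refl] by metis
  have desc: "\<mu> j \<le> \<mu> i" if "i < j" "j < n" for i j
  proof -
    have "quad n M (u j) \<le> \<mu> i * dot n (u j) (u j)"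
      using that by (intro ub) (auto simp: orth)
    moreover have "quad n M (u j) = \<mu> j * dot n (u j) (u j)"
      using that by (intro quad_eigenvector eig)
    ultimately show ?thesis using that orth by simp
  qed
  have "eigenvalues_desc (mat n n (\<lambda>(i, j). M i j)) = map \<mu> [0..<n]"
    using char_poly_eigenbasis[OF orth eig] desc
    by (intro eigenvalues_desc_eqI) (auto simp: sorted_wrt_iff_nth_less)
  then have "S2 (mat n n (\<lambda>(i, j). M i j)) = \<mu> 0 + \<mu> 1"
    using \<open>n \<ge> 2\<close> by (simp add: S2_def)
  moreover have "quad n M z \<le> \<mu> 0 * dot n z z" for z
    using ub[of 0 z] \<open>n \<ge> 2\<close> by simp
  moreover have "quad n M z \<le> \<mu> 1 * dot n z z" if "dot n (u 0) z = 0" for z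
    using ub[of 1 z] \<open>n \<ge> 2\<close> that by simp
  moreover have "dot n (u 0) (u 0) = 1" "dot n (u 1) (u 1) = 1" "dot n (u 0) (u 1) = 0"
    using \<open>n \<ge> 2\<close> orth[of 0 0] orth[of 1 1] orth[of 0 1] by simp_all
  moreover have "\<mu> 1 \<le> \<mu> 0" "\<forall>i<n. mat_app n M (u 0) i = \<mu> 0 * u 0 i"
    "\<forall>i<n. mat_app n M (u 1) i = \<mu> 1 * u 1 i"
    using \<open>n \<ge> 2\<close> desc[of 0 1] eig by simp_all
  ultimately show ?thesis by blast
qed

section \<open>Ky Fan's principle for two vectors\<close>

text \<open>A unit normal to (a, b), used to pick in a plane a unit vector orthogonal to a given
  one.\<close>

lemma exists_unit_combination:
  fixes a b :: real
  obtains c s where "c\<^sup>2 + s\<^sup>2 = 1" "c * a + s * b = 0"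
proof (cases "a = 0 \<and> b = 0")
  case True
  then show ?thesis using that[of 1 0] by simp
next
  case False
  then have pos: "a\<^sup>2 + b\<^sup>2 > 0" by (simp add: sum_power2_gt_zero_iff)
  let ?r = "sqrt (a\<^sup>2 + b\<^sup>2)"
  have "(b / ?r)\<^sup>2 + (- a / ?r)\<^sup>2 = (b\<^sup>2 + a\<^sup>2) / ?r\<^sup>2"
    by (simp only: power_divide add_divide_distrib power2_minus)
  also have "?r\<^sup>2 = b\<^sup>2 + a\<^sup>2" using pos by simp
  also have "(b\<^sup>2 + a\<^sup>2) / (b\<^sup>2 + a\<^sup>2) = 1" using pos by (intro divide_self) linarith
  finally show ?thesis by (rule that[of "b / ?r" "- a / ?r"]) (simp add: mult.commute)
qed

text \<open>Ky Fan: rotating \<open>x, y\<close> inside their span leaves the sum unchanged, and one of the rotated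
  vectors can be made orthogonal to the leading eigenvector.\<close>

lemma quad_pair_le_S2:
  assumes "n \<ge> 2" and sym: "\<And>i j. i < n \<Longrightarrow> j < n \<Longrightarrow> M i j = M j i"
    and x: "dot n x x = 1" and y: "dot n y y = 1" and xy: "dot n x y = 0"
  shows "quad n M x + quad n M y \<le> S2 (mat n n (\<lambda>(i, j). M i j))"
proof -
  obtain u0 \<mu>0 \<mu>1 where
    S2: "S2 (mat n n (\<lambda>(i, j). M i j)) = \<mu>0 + \<mu>1" and
    ub0: "\<And>z. quad n M z \<le> \<mu>0 * dot n z z" and
    ub1: "\<And>z. dot n u0 z = 0 \<Longrightarrow> quad n M z \<le> \<mu>1 * dot n z z"
    using S2_eigenvectors[of n M, OF assms(1) sym] by auto
  obtain c s where cs: "c\<^sup>2 + s\<^sup>2 = 1" "c * dot n u0 x + s * dot n u0 y = 0"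
    using exists_unit_combination by blast
  define w where "w = (\<lambda>i. c * x i + s * y i)"
  define w' where "w' = (\<lambda>i. (- s) * x i + c * y i)"
  have yx: "dot n y x = 0" using xy by (simp add: dot_commute)
  have "dot n w w = 1" "dot n w' w' = 1" "dot n u0 w = 0"
    unfolding w_def w'_def dot_lincomb_left dot_lincomb_right
    using cs by (auto simp: x y xy yx power2_eq_square)
  then have "quad n M w \<le> \<mu>1" "quad n M w' \<le> \<mu>0"
    using ub1[of w] ub0[of w'] by auto
  moreover have "quad n M w + quad n M w' = (c\<^sup>2 + s\<^sup>2) * (quad n M x + quad n M y)"
    unfolding w_def w'_def
    using quad_lincomb[of n M c x s y, OF sym] quad_lincomb[of n M "- s" x c y, OF sym]
    by (simp add: algebra_simps)
  ultimately show ?thesis using S2 cs(1) by simp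
qed

text \<open>Admits test vectors of any length, such as constant or integer ones.\<close>

lemma rayleigh_pair_le_S2:
  assumes "n \<ge> 2" and sym: "\<And>i j. i < n \<Longrightarrow> j < n \<Longrightarrow> M i j = M j i"
    and x: "dot n x x > 0" and y: "dot n y y > 0" and xy: "dot n x y = 0"
  shows "quad n M x / dot n x x + quad n M y / dot n y y \<le> S2 (mat n n (\<lambda>(i, j). M i j))"
proof -
  define a where "a = 1 / sqrt (dot n x x)"
  define b where "b = 1 / sqrt (dot n y y)"
  have a: "a * a * dot n x x = 1" and b: "b * b * dot n y y = 1"
    using x y by (simp_all add: a_def b_def)
  have "quad n M (\<lambda>i. a * x i) + quad n M (\<lambda>i. b * y i) \<le> S2 (mat n n (\<lambda>(i, j). M i j))"
    by (rule quad_pair_le_S2[OF assms(1) sym]) (simp_all add: dot_scale a b xy)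
  moreover have "a\<^sup>2 = 1 / dot n x x" "b\<^sup>2 = 1 / dot n y y"
    using x y by (simp_all add: a_def b_def power_divide)
  ultimately show ?thesis
    unfolding quad_scale by simp
qed

section \<open>Graphs and their quadratic forms\<close>

definition alpha_entry :: "real \<Rightarrow> nat \<Rightarrow> (nat \<Rightarrow> nat \<Rightarrow> bool) \<Rightarrow> nat \<Rightarrow> nat \<Rightarrow> real" where
  "alpha_entry \<alpha> n E i j =
    \<alpha> * (if i = j then real (degree n E i) else 0) + (1 - \<alpha>) * (if E i j then 1 else 0)"

definition edge_form :: "real \<Rightarrow> real \<Rightarrow> real \<Rightarrow> real" where
  "edge_form \<alpha> a b = \<alpha> * (a\<^sup>2 + b\<^sup>2) + 2 * (1 - \<alpha>) * (a * b)"

text \<open>Each edge occurs as two ordered pairs, hence the division by 2.\<close>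

definition graph_form :: "real \<Rightarrow> nat \<Rightarrow> (nat \<Rightarrow> nat \<Rightarrow> bool) \<Rightarrow> (nat \<Rightarrow> real) \<Rightarrow> real" where
  "graph_form \<alpha> n E x = (\<Sum>i<n. \<Sum>j<n. if E i j then edge_form \<alpha> (x i) (x j) else 0) / 2"

lemma A_alpha_eq_mat: "A_alpha \<alpha> n E = mat n n (\<lambda>(i, j). alpha_entry \<alpha> n E i j)"
  by (rule eq_matI) (auto simp: A_alpha_def deg_matrix_def adj_matrix_def alpha_entry_def)

lemma alpha_entry_symmetric:
  "simple_graph n E \<Longrightarrow> i < n \<Longrightarrow> j < n \<Longrightarrow> alpha_entry \<alpha> n E i j = alpha_entry \<alpha> n E j i"
  by (auto simp: alpha_entry_def simple_graph_def)

lemma edge_form_commute: "edge_form \<alpha> a b = edge_form \<alpha> b a"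
  by (simp add: edge_form_def algebra_simps)

text \<open>The two parts are the edge terms of the signless Laplacian and of the degree matrix; the
  tree certificates use the same split.\<close>

lemma edge_form_conv: "edge_form \<alpha> a b = (1 - \<alpha>) * (a + b)\<^sup>2 + (2 * \<alpha> - 1) * (a\<^sup>2 + b\<^sup>2)"
  by (simp add: edge_form_def algebra_simps power2_eq_square)

lemma edge_form_nonneg: "1/2 \<le> \<alpha> \<Longrightarrow> \<alpha> < 1 \<Longrightarrow> edge_form \<alpha> a b \<ge> 0"
  unfolding edge_form_conv by (intro add_nonneg_nonneg mult_nonneg_nonneg) auto

text \<open>The degree on the diagonal spreads \<open>\<alpha> * (x i)\<^sup>2\<close> over the
  edges at \<open>i\<close>. Averaging the sum with its transpose then treats both ends of an edge
  alike, which gives \<open>edge_form\<close>.\<close>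

lemma quad_alpha_entry:
  assumes "simple_graph n E"
  shows "quad n (alpha_entry \<alpha> n E) x = graph_form \<alpha> n E x"
proof -
  let ?e = "\<lambda>i j. if E i j then 1 else (0::real)"
  have sym: "?e i j = ?e j i" if "i < n" "j < n" for i j
    using assms that by (auto simp: simple_graph_def)
  have deg: "real (degree n E i) = (\<Sum>j<n. ?e i j)" for i
    by (simp add: degree_def sum.If_cases lessThan_def Collect_conj_eq)
  have "(\<Sum>j<n. x i * (alpha_entry \<alpha> n E i j * x j))
    = (\<Sum>j<n. ?e i j * (\<alpha> * (x i)\<^sup>2 + (1 - \<alpha>) * (x i * x j)))" if "i < n" for i
  proof -
    have "(\<Sum>j<n. x i * (alpha_entry \<alpha> n E i j * x j))
      = (\<Sum>j<n. (if i = j then \<alpha> * real (degree n E i) * (x i)\<^sup>2 else 0))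
        + (\<Sum>j<n. ?e i j * ((1 - \<alpha>) * (x i * x j)))"
      unfolding sum.distrib[symmetric]
      by (intro sum.cong refl) (auto simp: alpha_entry_def algebra_simps power2_eq_square)
    also have "(\<Sum>j<n. (if i = j then \<alpha> * real (degree n E i) * (x i)\<^sup>2 else 0))
      = (\<Sum>j<n. ?e i j * (\<alpha> * (x i)\<^sup>2))"
      unfolding sum_distrib_right[symmetric] deg[symmetric] using that by simp
    finally show ?thesis
      unfolding sum.distrib[symmetric] by (simp only: distrib_left)
  qed
  then have q: "quad n (alpha_entry \<alpha> n E) x
      = (\<Sum>i<n. \<Sum>j<n. ?e i j * (\<alpha> * (x i)\<^sup>2 + (1 - \<alpha>) * (x i * x j)))"
    by (simp add: quad_def dot_def mat_app_def sum_distrib_left)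
  have "(\<Sum>i<n. \<Sum>j<n. ?e i j * (\<alpha> * (x i)\<^sup>2 + (1 - \<alpha>) * (x i * x j)))
      = (\<Sum>j<n. \<Sum>i<n. ?e i j * (\<alpha> * (x i)\<^sup>2 + (1 - \<alpha>) * (x i * x j)))"
    by (rule sum.swap)
  also have "\<dots> = (\<Sum>i<n. \<Sum>j<n. ?e i j * (\<alpha> * (x j)\<^sup>2 + (1 - \<alpha>) * (x i * x j)))"
    by (intro sum.cong refl) (use sym in \<open>auto simp: mult.commute\<close>)
  finally have "2 * quad n (alpha_entry \<alpha> n E) x
      = (\<Sum>i<n. \<Sum>j<n. ?e i j * (\<alpha> * (x i)\<^sup>2 + (1 - \<alpha>) * (x i * x j)))
      + (\<Sum>i<n. \<Sum>j<n. ?e i j * (\<alpha> * (x j)\<^sup>2 + (1 - \<alpha>) * (x i * x j)))"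
    using q by simp
  also have "\<dots> = (\<Sum>i<n. \<Sum>j<n. if E i j then edge_form \<alpha> (x i) (x j) else 0)"
    unfolding sum.distrib[symmetric]
    by (intro sum.cong refl) (auto simp: edge_form_def algebra_simps)
  finally show ?thesis by (simp add: graph_form_def)
qed

lemma graph_form_pair_le_S2:
  assumes "simple_graph n E" "n \<ge> 2" "dot n x x > 0" "dot n y y > 0" "dot n x y = 0"
  shows "graph_form \<alpha> n E x / dot n x x + graph_form \<alpha> n E y / dot n y y \<le> S2 (A_alpha \<alpha> n E)"
  using rayleigh_pair_le_S2[of n "alpha_entry \<alpha> n E" x y, OF _ alpha_entry_symmetric] assms
  by (simp add: A_alpha_eq_mat quad_alpha_entry)

text \<open>The form is recorded on the whole plane of the two eigenvectors, where it is diagonal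
  because the cross term vanishes: the path argument needs a rotated vector of this plane.\<close>

lemma S2_graph_eigenvectors:
  assumes G: "simple_graph n E" and "n \<ge> 2"
  shows "\<exists>u0 u1 \<mu>0 \<mu>1. S2 (A_alpha \<alpha> n E) = \<mu>0 + \<mu>1 \<and> \<mu>1 \<le> \<mu>0 \<and>
    dot n u0 u0 = 1 \<and> dot n u1 u1 = 1 \<and> dot n u0 u1 = 0 \<and>
    (\<forall>a b. graph_form \<alpha> n E (\<lambda>i. a * u0 i + b * u1 i) = a\<^sup>2 * \<mu>0 + b\<^sup>2 * \<mu>1)"
proof -
  let ?M = "alpha_entry \<alpha> n E"
  obtain u0 u1 \<mu>0 \<mu>1 where
    S2: "S2 (mat n n (\<lambda>(i, j). ?M i j)) = \<mu>0 + \<mu>1" "\<mu>1 \<le> \<mu>0" and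
    orth: "dot n u0 u0 = 1" "dot n u1 u1 = 1" "dot n u0 u1 = 0" and
    eig: "\<And>i. i < n \<Longrightarrow> mat_app n ?M u0 i = \<mu>0 * u0 i" "\<And>i. i < n \<Longrightarrow> mat_app n ?M u1 i = \<mu>1 * u1 i"
    using S2_eigenvectors[of n ?M, OF assms(2) alpha_entry_symmetric[OF G]] by auto
  have "dot n u0 (mat_app n ?M u1) = dot n (\<lambda>i. 1 * u0 i) (\<lambda>i. \<mu>1 * u1 i)"
    by (intro dot_cong) (simp_all add: eig)
  also have "\<dots> = 0" unfolding dot_scale by (simp add: orth)
  finally have "graph_form \<alpha> n E (\<lambda>i. a * u0 i + b * u1 i) = a\<^sup>2 * \<mu>0 + b\<^sup>2 * \<mu>1" for a b
    using quad_lincomb[of n ?M a u0 b u1, OF alpha_entry_symmetric[OF G]]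
      quad_eigenvector[of n ?M u0 \<mu>0, OF eig(1)] quad_eigenvector[of n ?M u1 \<mu>1, OF eig(2)]
    by (simp add: quad_alpha_entry[OF G] orth)
  then show ?thesis using S2 orth unfolding A_alpha_eq_mat by blast
qed

section \<open>Embeddings and monotonicity\<close>

text \<open>Not induced on purpose: further edges can only raise the form on the given range of
  \<alpha>.\<close>

definition embeds :: "nat \<Rightarrow> (nat \<Rightarrow> nat \<Rightarrow> bool) \<Rightarrow> nat \<Rightarrow> (nat \<Rightarrow> nat \<Rightarrow> bool) \<Rightarrow> bool" where
  "embeds m E n F \<longleftrightarrow> (\<exists>f. inj_on f {..<m} \<and> f ` {..<m} \<subseteq> {..<n} \<and>
    (\<forall>i<m. \<forall>j<m. E i j \<longrightarrow> F (f i) (f j)))"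

lemma embedsI:
  assumes "inj_on f {..<m}" "\<And>i. i < m \<Longrightarrow> f i < n"
    and "\<And>i j. i < m \<Longrightarrow> j < m \<Longrightarrow> E i j \<Longrightarrow> F (f i) (f j)"
  shows "embeds m E n F"
  unfolding embeds_def using assms by (intro exI[of _ f]) auto

lemma embeds_trans:
  assumes "embeds m E n F" "embeds n F p G"
  shows "embeds m E p G"
proof -
  obtain f where f: "inj_on f {..<m}" "f ` {..<m} \<subseteq> {..<n}"
    "\<And>i j. i < m \<Longrightarrow> j < m \<Longrightarrow> E i j \<Longrightarrow> F (f i) (f j)"
    using assms(1) unfolding embeds_def by blast
  obtain g where g: "inj_on g {..<n}" "g ` {..<n} \<subseteq> {..<p}"
    "\<And>i j. i < n \<Longrightarrow> j < n \<Longrightarrow> F i j \<Longrightarrow> G (g i) (g j)"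
    using assms(2) unfolding embeds_def by blast
  show ?thesis
  proof (rule embedsI[of "g \<circ> f"])
    show "inj_on (g \<circ> f) {..<m}" using f g by (intro comp_inj_on) (auto intro: inj_on_subset)
    show "(g \<circ> f) i < p" if "i < m" for i using that f(2) g(2) by fastforce
    show "G ((g \<circ> f) i) ((g \<circ> f) j)" if "i < m" "j < m" "E i j" for i j
      using that f(2) by (auto intro!: g(3) f(3))
  qed
qed

text \<open>Extending the two leading eigenvectors by zero along the embedding preserves inner
  products, and edges not coming from \<open>E\<close> only add nonnegative terms, so Ky Fan applies
  in the larger graph.\<close>

lemma S2_mono_embeds:
  assumes "embeds m E n F" "simple_graph m E" "simple_graph n F" "m \<ge> 2" "1/2 \<le> \<alpha>" "\<alpha> < 1"
  shows "S2 (A_alpha \<alpha> m E) \<le> S2 (A_alpha \<alpha> n F)"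
proof -
  obtain f where f: "inj_on f {..<m}" "f ` {..<m} \<subseteq> {..<n}"
    "\<And>i j. i < m \<Longrightarrow> j < m \<Longrightarrow> E i j \<Longrightarrow> F (f i) (f j)"
    using assms(1) unfolding embeds_def by blast
  have "m \<le> n" using card_mono[OF _ f(2)] card_image[OF f(1)] by simp
  define push where "push = (\<lambda>(x :: nat \<Rightarrow> real) j. if j \<in> f ` {..<m} then x (inv_into {..<m} f j) else 0)"
  have push: "push x (f i) = x i" if "i < m" for x i
    using that f(1) by (simp add: push_def)
  have dot: "dot n (push x) (push y) = dot m x y" for x y
  proof -
    have "dot n (push x) (push y) = (\<Sum>j\<in>f ` {..<m}. push x j * push y j)"
      unfolding dot_def by (rule sum.mono_neutral_right) (use f(2) in \<open>auto simp: push_def\<close>)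
    also have "\<dots> = dot m x y"
      by (simp add: dot_def sum.reindex[OF f(1)] push)
    finally show ?thesis .
  qed
  have form: "graph_form \<alpha> m E x \<le> graph_form \<alpha> n F (push x)" for x
  proof -
    define h where "h = (\<lambda>i j. if F i j then edge_form \<alpha> (push x i) (push x j) else 0)"
    have h: "h i j \<ge> 0" for i j using edge_form_nonneg assms(5,6) by (simp add: h_def)
    have "(\<Sum>i<m. \<Sum>j<m. if E i j then edge_form \<alpha> (x i) (x j) else 0)
        \<le> (\<Sum>i<m. \<Sum>j<m. h (f i) (f j))"
      using f(3) edge_form_nonneg assms(5,6) by (intro sum_mono) (auto simp: h_def push)
    also have "\<dots> = (\<Sum>i\<in>f ` {..<m}. \<Sum>j\<in>f ` {..<m}. h i j)"
      by (simp add: sum.reindex[OF f(1)])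
    also have "\<dots> \<le> (\<Sum>i\<in>f ` {..<m}. \<Sum>j<n. h i j)"
      using f(2) h by (intro sum_mono sum_mono2) auto
    also have "\<dots> \<le> (\<Sum>i<n. \<Sum>j<n. h i j)"
      using f(2) h by (intro sum_mono2) (auto intro: sum_nonneg)
    finally show ?thesis by (simp add: graph_form_def h_def)
  qed
  obtain u0 u1 \<mu>0 \<mu>1 where S2: "S2 (A_alpha \<alpha> m E) = \<mu>0 + \<mu>1" and
    orth: "dot m u0 u0 = 1" "dot m u1 u1 = 1" "dot m u0 u1 = 0" and
    lin: "\<And>a b. graph_form \<alpha> m E (\<lambda>i. a * u0 i + b * u1 i) = a\<^sup>2 * \<mu>0 + b\<^sup>2 * \<mu>1"
    using S2_graph_eigenvectors[OF assms(2,4), of \<alpha>] by blast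
  have "graph_form \<alpha> m E u0 = \<mu>0" "graph_form \<alpha> m E u1 = \<mu>1"
    using lin[of 1 0] lin[of 0 1] by simp_all
  then have "S2 (A_alpha \<alpha> m E) \<le> graph_form \<alpha> n F (push u0) + graph_form \<alpha> n F (push u1)"
    using form[of u0] form[of u1] S2 by simp
  also have "\<dots> \<le> S2 (A_alpha \<alpha> n F)"
    using graph_form_pair_le_S2[OF assms(3), of "push u0" "push u1" \<alpha>] \<open>m \<le> n\<close> assms(4)
    by (simp add: dot orth)
  finally show ?thesis .
qed

text \<open>Embeddings in both directions give equal \<open>S2\<close> by monotonicity, in place of
  a similarity by permutation matrices.\<close>

lemma graph_iso_imp_embeds:
  assumes "graph_iso n E F"
  shows "embeds n E n F" "embeds n F n E"
proof -
  obtain f where f: "bij_betw f {..<n} {..<n}" "\<And>i j. i < n \<Longrightarrow> j < n \<Longrightarrow> E i j \<longleftrightarrow> F (f i) (f j)"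
    using assms unfolding graph_iso_def atLeast0LessThan by blast
  show "embeds n E n F"
    using f by (intro embedsI[of f]) (auto simp: bij_betw_def)
  let ?g = "inv_into {..<n} f"
  have g: "bij_betw ?g {..<n} {..<n}" by (rule bij_betw_inv_into[OF f(1)])
  have fg: "f (?g i) = i" "?g i < n" if "i < n" for i
    using f(1) g that bij_betw_inv_into_right[OF f(1)] bij_betwE[OF g] by auto
  show "embeds n F n E"
    using g fg f(2) by (intro embedsI[of ?g]) (auto simp: bij_betw_def)
qed

section \<open>Trees given by parent lists\<close>

text \<open>A list \<open>ps\<close> encodes the tree on \<open>{0..length ps}\<close> in which the parent of \<open>k + 1\<close> is \<open>ps ! k\<close>.\<close>

definition tree_adj :: "nat list \<Rightarrow> nat \<Rightarrow> nat \<Rightarrow> bool" where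
  "tree_adj ps i j \<longleftrightarrow> j < i \<and> ps ! (i - 1) = j \<or> i < j \<and> ps ! (j - 1) = i"

definition contains_tree :: "nat \<Rightarrow> (nat \<Rightarrow> nat \<Rightarrow> bool) \<Rightarrow> nat list \<Rightarrow> bool" where
  "contains_tree n E ps \<longleftrightarrow> embeds (Suc (length ps)) (tree_adj ps) n E"

lemma simple_graph_tree_adj: "simple_graph n (tree_adj ps)"
  by (auto simp: simple_graph_def tree_adj_def)

text \<open>Charging each edge to its child leaves one term per nonroot vertex; the opposite
  orientation contributes the same sum and cancels the half in \<open>graph_form\<close>.\<close>

lemma graph_form_tree:
  assumes "\<And>k. k < length ps \<Longrightarrow> ps ! k \<le> k"
  shows "graph_form \<alpha> (Suc (length ps)) (tree_adj ps) x
    = (\<Sum>k<length ps. edge_form \<alpha> (x (Suc k)) (x (ps ! k)))"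
proof -
  let ?m = "length ps"
  let ?h = "\<lambda>i j. if j < i \<and> ps ! (i - 1) = j then edge_form \<alpha> (x i) (x j) else 0"
  have split: "(if tree_adj ps i j then edge_form \<alpha> (x i) (x j) else 0) = ?h i j + ?h j i" for i j
    by (auto simp: tree_adj_def edge_form_commute)
  have "(\<Sum>i<Suc ?m. \<Sum>j<Suc ?m. ?h j i) = (\<Sum>i<Suc ?m. \<Sum>j<Suc ?m. ?h i j)"
    by (rule sum.swap)
  then have "graph_form \<alpha> (Suc ?m) (tree_adj ps) x = (\<Sum>i<Suc ?m. \<Sum>j<Suc ?m. ?h i j)"
    unfolding graph_form_def split sum.distrib by simp
  also have "\<dots> = (\<Sum>k<?m. \<Sum>j<Suc ?m. ?h (Suc k) j)"
    by (subst sum.lessThan_Suc_shift) simp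
  also have "\<dots> = (\<Sum>k<?m. edge_form \<alpha> (x (Suc k)) (x (ps ! k)))"
  proof (rule sum.cong[OF refl])
    fix k assume k: "k \<in> {..<?m}"
    have "(\<Sum>j<Suc ?m. ?h (Suc k) j)
        = (\<Sum>j<Suc ?m. if ps ! k = j then edge_form \<alpha> (x (Suc k)) (x j) else 0)"
      using assms[of k] k by (intro sum.cong refl) auto
    also have "\<dots> = edge_form \<alpha> (x (Suc k)) (x (ps ! k))"
      using assms[of k] k by (subst sum.delta') auto
    finally show "(\<Sum>j<Suc ?m. ?h (Suc k) j) = edge_form \<alpha> (x (Suc k)) (x (ps ! k))" .
  qed
  finally show ?thesis .
qed

section \<open>Growing trees in connected graphs\<close>

text \<open>Otherwise no walk starting in \<open>S\<close> could ever leave it.\<close>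

lemma exists_boundary_edge:
  assumes "graph_connected n E" "S \<subseteq> {..<n}" "S \<noteq> {}" "S \<noteq> {..<n}"
  shows "\<exists>v\<in>S. \<exists>w<n. w \<notin> S \<and> E v w"
proof (rule ccontr)
  assume *: "\<not> ?thesis"
  obtain a b where ab: "a \<in> S" "b < n" "b \<notin> S" using assms by blast
  have "(\<lambda>u v. u < n \<and> v < n \<and> E u v)\<^sup>*\<^sup>* a b"
    using assms(1,2) ab unfolding graph_connected_def by blast
  then have "b \<in> S"
    by (induction rule: rtranclp_induct) (use ab * in auto)
  then show False using ab by simp
qed

text \<open>A boundary edge of the image attaches a leaf. Being the newest vertex, the leaf only
  appends its parent to the list, and the earlier entries stay valid.\<close>

lemma contains_tree_extend:
  assumes "simple_graph n E" "graph_connected n E" "contains_tree n E ps" "Suc (length ps) < n"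
  shows "\<exists>k\<le>length ps. contains_tree n E (ps @ [k])"
proof -
  let ?m = "Suc (length ps)"
  obtain f where f: "inj_on f {..<?m}" "f ` {..<?m} \<subseteq> {..<n}"
    "\<And>i j. i < ?m \<Longrightarrow> j < ?m \<Longrightarrow> tree_adj ps i j \<Longrightarrow> E (f i) (f j)"
    using assms(3) unfolding contains_tree_def embeds_def by blast
  have "card (f ` {..<?m}) < n" using card_image[OF f(1)] assms(4) by simp
  then have "f ` {..<?m} \<noteq> {..<n}" by force
  then obtain k w where k: "k < ?m" and w: "w < n" "w \<notin> f ` {..<?m}" "E (f k) w"
    using exists_boundary_edge[OF assms(2) f(2)] by blast
  define g where "g = f(?m := w)"
  have g: "g i = f i" if "i < ?m" for i using that by (simp add: g_def)
  have E_sym: "E a b \<Longrightarrow> a < n \<Longrightarrow> b < n \<Longrightarrow> E b a" for a b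
    using assms(1) by (simp add: simple_graph_def)
  have "contains_tree n E (ps @ [k])"
    unfolding contains_tree_def
  proof (rule embedsI[of g])
    show "inj_on g {..<Suc (length (ps @ [k]))}"
      using f(1) w(2) by (auto simp: g_def lessThan_Suc[of ?m] inj_on_def)
    show g_less: "g i < n" if "i < Suc (length (ps @ [k]))" for i
      using that f(2) w(1) by (cases "i = ?m") (auto simp: g_def image_subset_iff)
    have half: "E (g i) (g j)" if "i < Suc (length (ps @ [k]))" "j < i" "(ps @ [k]) ! (i - 1) = j" for i j
    proof (cases "i = ?m")
      case True
      then have "j = k" using that by (simp add: nth_append)
      then have "E (f j) w" "f j < n" using k w(3) f(2) by auto
      then have "E w (f j)" using E_sym w(1) by blast
      then show ?thesis using True k \<open>j = k\<close> by (simp add: g_def)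
    next
      case False
      then have "tree_adj ps i j" using that by (auto simp: tree_adj_def nth_append)
      then show ?thesis using f(3)[of i j] False that g by simp
    qed
    show "E (g i) (g j)" if "i < Suc (length (ps @ [k]))" "j < Suc (length (ps @ [k]))"
      "tree_adj (ps @ [k]) i j" for i j
    proof -
      have "g i < n" "g j < n" using that(1,2) g_less by blast+
      then show ?thesis using that half[of i j] half[of j i] E_sym unfolding tree_adj_def by blast
    qed
  qed
  then show ?thesis using k less_Suc_eq_le by blast
qed

section \<open>Paths\<close>

lemma simple_graph_path: "simple_graph n path_adj"
  by (auto simp: simple_graph_def path_adj_def)

text \<open>The path is the tree in which the parent of \<open>k + 1\<close> is \<open>k\<close>, so
  the tree formula covers its form.\<close>

lemma tree_adj_upt: "i \<le> m \<Longrightarrow> j \<le> m \<Longrightarrow> tree_adj [0..<m] i j \<longleftrightarrow> path_adj i j"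
  by (auto simp: tree_adj_def path_adj_def)

lemma graph_form_path: "graph_form \<alpha> (Suc m) path_adj x = (\<Sum>k<m. edge_form \<alpha> (x (Suc k)) (x k))"
proof -
  have "graph_form \<alpha> (Suc m) path_adj x = graph_form \<alpha> (Suc m) (tree_adj [0..<m]) x"
    unfolding graph_form_def by (intro arg_cong2[where f = "(/)"] sum.cong refl) (simp add: tree_adj_upt)
  then show ?thesis using graph_form_tree[of "[0..<m]" \<alpha> x] by simp
qed

text \<open>Per edge, \<open>edge_form\<close> plus the weighted squared difference is the sum of
  the two squares. Inner vertices lie on two edges and ends on one, which the two extra squares make
  up for.\<close>

lemma path_form_defect:
  "(\<Sum>k<m. edge_form \<alpha> (x (Suc k)) (x k)) + (1 - \<alpha>) * (\<Sum>k<m. (x (Suc k) - x k)\<^sup>2) + (x 0)\<^sup>2 + (x m)\<^sup>2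
    = 2 * dot (Suc m) x x"
  by (induction m) (simp_all add: dot_def edge_form_def algebra_simps power2_eq_square)

text \<open>If the defect vanished, the differences, weighted by 1 - \<alpha> > 0, would make
  \<open>x\<close> constant, and the end term would make it zero.\<close>

lemma path_form_less:
  assumes "\<alpha> < 1" "dot n x x > 0"
  shows "graph_form \<alpha> n path_adj x < 2 * dot n x x"
proof (cases n)
  case 0
  then show ?thesis using assms by (simp add: dot_def)
next
  case (Suc m)
  let ?D = "\<Sum>k<m. (x (Suc k) - x k)\<^sup>2"
  have D: "?D \<ge> 0" by (simp add: sum_nonneg)
  show ?thesis
  proof (rule ccontr)
    assume "\<not> ?thesis"
    then have *: "(1 - \<alpha>) * ?D + (x 0)\<^sup>2 + (x m)\<^sup>2 \<le> 0"
      using path_form_defect[of \<alpha> x m] Suc by (simp add: graph_form_path)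
    have "(1 - \<alpha>) * ?D \<ge> 0" using D assms(1) by simp
    then have "(1 - \<alpha>) * ?D = 0" "(x 0)\<^sup>2 = 0"
      using * zero_le_power2[of "x 0"] zero_le_power2[of "x m"] by linarith+
    then have "?D = 0" "x 0 = 0" using assms(1) by simp_all
    then have step: "x (Suc k) = x k" if "k < m" for k
      using that by (simp add: sum_nonneg_eq_0_iff)
    have "x i = 0" if "i \<le> m" for i
      using that by (induction i) (simp_all add: \<open>x 0 = 0\<close> step)
    then have "dot n x x = 0" using Suc by (simp add: dot_def)
    then show False using assms(2) by simp
  qed
qed

lemma S2_path_less:
  assumes "n \<ge> 2" "\<alpha> < 1"
  shows "S2 (A_alpha \<alpha> n path_adj) < 4"
proof -
  obtain u0 u1 \<mu>0 \<mu>1 where S2: "S2 (A_alpha \<alpha> n path_adj) = \<mu>0 + \<mu>1" and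
    orth: "dot n u0 u0 = 1" "dot n u1 u1 = 1" and
    lin: "\<And>a b. graph_form \<alpha> n path_adj (\<lambda>i. a * u0 i + b * u1 i) = a\<^sup>2 * \<mu>0 + b\<^sup>2 * \<mu>1"
    using S2_graph_eigenvectors[OF simple_graph_path assms(1), of \<alpha>] by blast
  show ?thesis
    using path_form_less[OF assms(2), of n u0] path_form_less[OF assms(2), of n u1]
      lin[of 1 0] lin[of 0 1] orth S2 by simp
qed

lemma S2_path_less_supergraph:
  assumes G: "simple_graph n E" and n: "n \<ge> 2" and \<alpha>: "1/2 \<le> \<alpha>" "\<alpha> < 1"
    and path: "\<And>i j. i < n \<Longrightarrow> j < n \<Longrightarrow> path_adj i j \<Longrightarrow> E i j"
    and extra: "a < n" "b < n" "E a b" "\<not> path_adj a b"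
  shows "S2 (A_alpha \<alpha> n path_adj) < S2 (A_alpha \<alpha> n E)"
proof -
  obtain u0 u1 \<mu>0 \<mu>1 where S2: "S2 (A_alpha \<alpha> n path_adj) = \<mu>0 + \<mu>1" "\<mu>1 \<le> \<mu>0" and
    orth: "dot n u0 u0 = 1" "dot n u1 u1 = 1" "dot n u0 u1 = 0" and
    lin: "\<And>a b. graph_form \<alpha> n path_adj (\<lambda>i. a * u0 i + b * u1 i) = a\<^sup>2 * \<mu>0 + b\<^sup>2 * \<mu>1"
    using S2_graph_eigenvectors[OF simple_graph_path n, of \<alpha>] by blast
  have "\<mu>0 < 2"
    using path_form_less[OF \<alpha>(2), of n u0] lin[of 1 0] orth by simp
  let ?one = "\<lambda>_ :: nat. 1 :: real"
  obtain c s where cs: "c\<^sup>2 + s\<^sup>2 = 1" "c * dot n u0 ?one + s * dot n u1 ?one = 0"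
    using exists_unit_combination by blast
  define w where "w = (\<lambda>i. c * u0 i + s * u1 i)"
  have w: "dot n w w = 1" "dot n ?one w = 0"
    unfolding w_def dot_lincomb_left dot_lincomb_right
    using cs orth by (simp_all add: dot_commute[of n u1 u0] dot_commute[of n ?one] power2_eq_square)
  \<comment> \<open>As a unit vector of the leading plane, \<open>w\<close> has an average of
    \<open>\<mu>0\<close> and \<open>\<mu>1\<close> as its value, hence at least
    \<open>\<mu>1\<close>.\<close>
  have "\<mu>1 = c\<^sup>2 * \<mu>1 + s\<^sup>2 * \<mu>1" using cs(1) by (simp flip: distrib_right)
  also have "\<dots> \<le> c\<^sup>2 * \<mu>0 + s\<^sup>2 * \<mu>1" using S2(2) by (simp add: mult_left_mono)
  also have "\<dots> = graph_form \<alpha> n path_adj w" by (simp add: w_def lin)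
  also have "\<dots> \<le> graph_form \<alpha> n E w"
    unfolding graph_form_def using edge_form_nonneg[OF \<alpha>] path
    by (intro divide_right_mono sum_mono) auto
  finally have form_w: "\<mu>1 \<le> graph_form \<alpha> n E w" .
  have ba: "E b a" "\<not> path_adj b a" "a \<noteq> b"
    using G extra by (auto simp: simple_graph_def path_adj_def)
  have one: "edge_form \<alpha> 1 1 = 2" by (simp add: edge_form_def)
  obtain m where m: "n = Suc m" using n by (cases n) auto
  have delta: "(\<Sum>i<n. \<Sum>j<n. if i = p \<and> j = q then 2 else 0) = (2::real)" if "p < n" "q < n" for p q
  proof -
    have "(\<Sum>i<n. \<Sum>j<n. if i = p \<and> j = q then 2 else 0) = (\<Sum>i<n. if i = p then (\<Sum>j<n. if j = q then 2 else 0) else (0::real))"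
      by (intro sum.cong refl) auto
    then show ?thesis using that by simp
  qed
  \<comment> \<open>In the doubled form every ordered adjacent pair counts 2. The path gives 4 (n -
    1) and the extra edge, in both orientations, 4 more, which makes 4 n.\<close>
  have "2 * graph_form \<alpha> n path_adj ?one + 2 + 2
    = (\<Sum>i<n. \<Sum>j<n. (if path_adj i j then 2 else 0) + (if i = a \<and> j = b then 2 else 0)
        + (if i = b \<and> j = a then 2 else 0))"
    unfolding sum.distrib graph_form_def one using delta extra(1,2) by simp
  also have "\<dots> \<le> (\<Sum>i<n. \<Sum>j<n. if E i j then 2 else 0)"
    using path extra ba by (intro sum_mono) auto
  also have "\<dots> = 2 * graph_form \<alpha> n E ?one" unfolding graph_form_def one by simp
  finally have "2 * dot n ?one ?one \<le> graph_form \<alpha> n E ?one"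
    using m by (simp add: graph_form_path one dot_def)
  moreover have "dot n ?one ?one > 0" using m by (simp add: dot_def)
  ultimately have "2 \<le> graph_form \<alpha> n E ?one / dot n ?one ?one"
    by (simp add: pos_le_divide_eq)
  moreover have "graph_form \<alpha> n E ?one / dot n ?one ?one + graph_form \<alpha> n E w / dot n w w \<le> S2 (A_alpha \<alpha> n E)"
    by (rule graph_form_pair_le_S2[OF G n]) (use w \<open>dot n ?one ?one > 0\<close> in auto)
  ultimately show ?thesis using S2 \<open>\<mu>0 < 2\<close> form_w w(1) by simp
qed

text \<open>A vertex outside a longest path but joined to it cannot be joined to an end, as the path
  would grow. So it is joined to an inner vertex, which is the centre of a claw together with its
  two path neighbours.\<close>

lemma hamiltonian_path_or_claw:
  assumes G: "simple_graph n E" and con: "graph_connected n E" and "n \<ge> 1"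
  shows "embeds n path_adj n E \<or> contains_tree n E [0, 0, 0]"
proof -
  define P where "P m \<longleftrightarrow> embeds (Suc m) path_adj n E" for m
  have "P 0"
    unfolding P_def using \<open>n \<ge> 1\<close> by (intro embedsI[of "\<lambda>_. 0"]) (auto simp: path_adj_def inj_on_def)
  moreover have bound: "m < n" if "P m" for m
    using that unfolding P_def embeds_def
    by (metis Suc_le_eq card_image card_lessThan card_mono finite_lessThan)
  ultimately obtain m where m: "P m" "\<And>k. P k \<Longrightarrow> k \<le> m"
    by (metis Nat.ex_has_greatest_nat less_imp_le_nat)
  show ?thesis
  proof (cases "Suc m = n")
    case True
    then show ?thesis using m(1) by (simp add: P_def)
  next
    case False
    obtain f where f: "inj_on f {..<Suc m}" "f ` {..<Suc m} \<subseteq> {..<n}"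
      "\<And>i j. i < Suc m \<Longrightarrow> j < Suc m \<Longrightarrow> path_adj i j \<Longrightarrow> E (f i) (f j)"
      using m(1) unfolding P_def embeds_def by blast
    have "card (f ` {..<Suc m}) < n" using card_image[OF f(1)] False bound[OF m(1)] by simp
    then have "f ` {..<Suc m} \<noteq> {..<n}" by force
    then obtain k w where "k < Suc m" and w: "w < n" "w \<notin> f ` {..<Suc m}" "E (f k) w"
      using exists_boundary_edge[OF con f(2)] by blast
    then have k: "k \<le> m" by simp
    have fn: "f i < n" if "i \<le> m" for i using f(2) that by (auto simp: image_subset_iff)
    have E_sym: "E a b \<Longrightarrow> a < n \<Longrightarrow> b < n \<Longrightarrow> E b a" for a b
      using G by (simp add: simple_graph_def)
    have wk: "E w (f k)" using E_sym[OF w(3) fn[OF k] w(1)] .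
    have inj: "f i = f j \<longleftrightarrow> i = j" if "i \<le> m" "j \<le> m" for i j
      using inj_on_eq_iff[OF f(1)] that by simp
    have wf: "w \<noteq> f i" if "i \<le> m" for i using w(2) that by auto
    have adj: "E (f i) (f (Suc i))" "E (f (Suc i)) (f i)" if "i < m" for i
      using that by (auto intro!: f(3) simp: path_adj_def)
    have "\<not> P (Suc m)" using m(2)[of "Suc m"] by auto
    have "k \<noteq> m"
    proof
      assume "k = m"
      have "embeds (Suc (Suc m)) path_adj n E"
      proof (rule embedsI[of "f(Suc m := w)"])
        show "inj_on (f(Suc m := w)) {..<Suc (Suc m)}"
          using f(1) w(2) by (auto simp: inj_on_def lessThan_Suc[of "Suc m"])
      qed (use \<open>k = m\<close> w(1) fn w(3) wk adj in \<open>auto simp: path_adj_def less_Suc_eq_le le_less\<close>)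
      then show False using \<open>\<not> P (Suc m)\<close> by (simp add: P_def)
    qed
    moreover have "k \<noteq> 0"
    proof
      assume "k = 0"
      \<comment> \<open>Puts \<open>w\<close> in front and shifts the path by one.\<close>
      define g where "g = case_nat w f"
      have "embeds (Suc (Suc m)) path_adj n E"
      proof (rule embedsI[of g])
        show "inj_on g {..<Suc (Suc m)}"
          using inj wf by (auto simp: inj_on_def g_def less_Suc_eq_le split: nat.split)
             (metis wf)+
        show "g i < n" if "i < Suc (Suc m)" for i
          using that fn w(1) by (auto simp: g_def split: nat.split)
        show "E (g i) (g j)" if "i < Suc (Suc m)" "j < Suc (Suc m)" "path_adj i j" for i j
          using that adj wk w(3) \<open>k = 0\<close>
          by (cases i; cases j) (auto simp: g_def path_adj_def)
      qed
      then show False using \<open>\<not> P (Suc m)\<close> by (simp add: P_def)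
    qed
    ultimately obtain l where l: "k = Suc l" "Suc (Suc l) \<le> m"
      using k by (cases k) auto
    have "contains_tree n E [0, 0, 0]"
      unfolding contains_tree_def
    proof (rule embedsI[of "\<lambda>i. [f k, f l, f (Suc k), w] ! i"])
      show "inj_on (\<lambda>i. [f k, f l, f (Suc k), w] ! i) {..<Suc (length [0::nat, 0, 0])}"
        using l inj wf[of l] wf[of k] wf[of "Suc k"] by (intro inj_on_nth) auto
      show "[f k, f l, f (Suc k), w] ! i < n" if "i < Suc (length [0::nat, 0, 0])" for i
        using that l fn w(1) by (auto simp: less_Suc_eq)
      show "E ([f k, f l, f (Suc k), w] ! i) ([f k, f l, f (Suc k), w] ! j)"
        if "i < Suc (length [0::nat, 0, 0])" "j < Suc (length [0::nat, 0, 0])" "tree_adj [0, 0, 0] i j" for i j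
        using that l adj[of l] adj[of k] w(3) wk
        by (auto simp: less_Suc_eq tree_adj_def)
    qed
    then show ?thesis ..
  qed
qed

text \<open>The embedding is a bijection, so \<open>E\<close> can be pulled back along it to a graph
  \<open>F\<close> that contains the path literally. Either \<open>F\<close> has no other edge, or
  the strict comparison holds for \<open>F\<close> and passes to \<open>E\<close>.\<close>

lemma graph_iso_path_or_S2_less:
  assumes G: "simple_graph n E" and n: "n \<ge> 2" and \<alpha>: "1/2 \<le> \<alpha>" "\<alpha> < 1"
    and ham: "embeds n path_adj n E"
  shows "graph_iso n E path_adj \<or> S2 (A_alpha \<alpha> n path_adj) < S2 (A_alpha \<alpha> n E)"
proof -
  obtain f where f: "inj_on f {..<n}" "f ` {..<n} \<subseteq> {..<n}"
    "\<And>i j. i < n \<Longrightarrow> j < n \<Longrightarrow> path_adj i j \<Longrightarrow> E (f i) (f j)"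
    using ham unfolding embeds_def by blast
  have bij: "bij_betw f {..<n} {..<n}"
    using f(1,2) by (simp add: bij_betw_def endo_inj_surj)
  define F where "F i j \<longleftrightarrow> E (f i) (f j)" for i j
  have "f i < n" if "i < n" for i using f(2) that by (auto simp: image_subset_iff)
  then have F: "simple_graph n F"
    using G unfolding simple_graph_def F_def by simp
  have "embeds n F n E"
    using f by (intro embedsI[of f]) (auto simp: F_def)
  then have le: "S2 (A_alpha \<alpha> n F) \<le> S2 (A_alpha \<alpha> n E)"
    by (rule S2_mono_embeds[OF _ F G n \<alpha>])
  show ?thesis
  proof (cases "\<forall>i<n. \<forall>j<n. F i j \<longrightarrow> path_adj i j")
    case True
    let ?g = "inv_into {..<n} f"
    have g: "bij_betw ?g {..<n} {..<n}" by (rule bij_betw_inv_into[OF bij])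
    have fg: "f (?g i) = i" "?g i < n" if "i < n" for i
      using g that bij_betw_inv_into_right[OF bij] bij_betwE[OF g] by auto
    have "E i j \<longleftrightarrow> path_adj (?g i) (?g j)" if "i < n" "j < n" for i j
    proof -
      have "E i j \<longleftrightarrow> F (?g i) (?g j)" by (simp add: F_def fg that)
      also have "\<dots> \<longleftrightarrow> path_adj (?g i) (?g j)"
        using True f(3)[of "?g i" "?g j"] fg(2)[OF that(1)] fg(2)[OF that(2)] unfolding F_def by blast
      finally show ?thesis .
    qed
    then show ?thesis using g unfolding graph_iso_def atLeast0LessThan by blast
  next
    case False
    then obtain a b where "a < n" "b < n" "F a b" "\<not> path_adj a b" by blast
    then have "S2 (A_alpha \<alpha> n path_adj) < S2 (A_alpha \<alpha> n F)"
      using f(3) by (intro S2_path_less_supergraph[OF F n \<alpha>]) (auto simp: F_def)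
    then show ?thesis using le by simp
  qed
qed

section \<open>Trees with large \<open>S\<^sub>2\<close>\<close>

definition int_dot :: "int list \<Rightarrow> int list \<Rightarrow> int" where
  "int_dot xs ys = sum_list (map2 (*) xs ys)"

definition signless_form :: "nat list \<Rightarrow> int list \<Rightarrow> int" where
  "signless_form ps xs = (\<Sum>k\<leftarrow>[0..<length ps]. (xs ! Suc k + xs ! (ps ! k))\<^sup>2)"

definition degree_form :: "nat list \<Rightarrow> int list \<Rightarrow> int" where
  "degree_form ps xs = (\<Sum>k\<leftarrow>[0..<length ps]. (xs ! Suc k)\<^sup>2 + (xs ! (ps ! k))\<^sup>2)"

text \<open>\<open>A\<^sub>\<alpha>\<close> is affine in \<open>\<alpha>\<close>, so fixed orthogonal test vectors certify \<open>S\<^sub>2 \<ge> 4\<close> on all of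
  \<open>[1/2, 1)\<close> once they do so at \<open>\<alpha> = 1/2\<close> (half the signless Laplacian) and \<open>\<alpha> = 1\<close> (the degrees).\<close>

fun S2_certificate :: "nat list \<times> int list \<times> int list \<Rightarrow> bool" where
  "S2_certificate (ps, xs, ys) \<longleftrightarrow>
    length xs = Suc (length ps) \<and> length ys = Suc (length ps) \<and>
    list_all (\<lambda>k. ps ! k \<le> k) [0..<length ps] \<and>
    int_dot xs ys = 0 \<and> 0 < int_dot xs xs \<and> 0 < int_dot ys ys \<and>
    8 * (int_dot xs xs * int_dot ys ys)
      \<le> signless_form ps xs * int_dot ys ys + signless_form ps ys * int_dot xs xs \<and>
    4 * (int_dot xs xs * int_dot ys ys)
      \<le> degree_form ps xs * int_dot ys ys + degree_form ps ys * int_dot xs xs"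

text \<open>\<open>g ! i\<close> is the vertex of the tree \<open>ps\<close> that receives vertex
  \<open>i\<close> of \<open>qs\<close>. Testing the edges to parents suffices, as these are all
  edges of \<open>qs\<close>.\<close>

definition embedding_check :: "nat list \<Rightarrow> nat list \<Rightarrow> nat list \<Rightarrow> bool" where
  "embedding_check qs ps g \<longleftrightarrow>
    length g = Suc (length qs) \<and> distinct g \<and> list_all (\<lambda>i. i \<le> length ps) g \<and>
    list_all (\<lambda>k. tree_adj ps (g ! Suc k) (g ! (qs ! k))) [0..<length qs]"

lemma int_dot_conv:
  assumes "length xs = n" "length ys = n"
  shows "real_of_int (int_dot xs ys) = dot n (\<lambda>i. real_of_int (xs ! i)) (\<lambda>i. real_of_int (ys ! i))"
  using assms
  by (simp add: int_dot_def dot_def sum_list_sum_nth atLeast0LessThan)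

lemma graph_form_tree_int:
  assumes "\<And>k. k < length ps \<Longrightarrow> ps ! k \<le> k"
  shows "graph_form \<alpha> (Suc (length ps)) (tree_adj ps) (\<lambda>i. real_of_int (xs ! i))
    = (1 - \<alpha>) * real_of_int (signless_form ps xs) + (2 * \<alpha> - 1) * real_of_int (degree_form ps xs)"
proof -
  have "graph_form \<alpha> (Suc (length ps)) (tree_adj ps) (\<lambda>i. real_of_int (xs ! i))
    = (\<Sum>k<length ps. edge_form \<alpha> (real_of_int (xs ! Suc k)) (real_of_int (xs ! (ps ! k))))"
    by (rule graph_form_tree[OF assms])
  then show ?thesis
    unfolding edge_form_conv sum.distrib sum_distrib_left[symmetric]
    by (simp add: signless_form_def degree_form_def sum_list_sum_nth atLeast0LessThan sum.distrib)
qed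

lemma S2_certificate_sound:
  assumes cert: "S2_certificate (ps, xs, ys)" and emb: "contains_tree n E ps"
    and G: "simple_graph n E" and \<alpha>: "1/2 \<le> \<alpha>" "\<alpha> < 1" and "ps \<noteq> []"
  shows "4 \<le> S2 (A_alpha \<alpha> n E)"
proof -
  let ?m = "Suc (length ps)"
  let ?x = "\<lambda>i. real_of_int (xs ! i)" and ?y = "\<lambda>i. real_of_int (ys ! i)"
  define X where "X = real_of_int (int_dot xs xs)"
  define Y where "Y = real_of_int (int_dot ys ys)"
  have len: "length xs = ?m" "length ys = ?m" and par: "\<And>k. k < length ps \<Longrightarrow> ps ! k \<le> k"
    using cert by (auto simp: list_all_iff)
  have dots: "dot ?m ?x ?x = X" "dot ?m ?y ?y = Y" "dot ?m ?x ?y = real_of_int (int_dot xs ys)"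
    using len by (simp_all add: int_dot_conv X_def Y_def)
  have pos: "X > 0" "Y > 0" using cert by (simp_all add: X_def Y_def)
  let ?Qx = "real_of_int (signless_form ps xs)" and ?Qy = "real_of_int (signless_form ps ys)"
  let ?Dx = "real_of_int (degree_form ps xs)" and ?Dy = "real_of_int (degree_form ps ys)"
  have "real_of_int (8 * (int_dot xs xs * int_dot ys ys))
      \<le> real_of_int (signless_form ps xs * int_dot ys ys + signless_form ps ys * int_dot xs xs)"
    "real_of_int (4 * (int_dot xs xs * int_dot ys ys))
      \<le> real_of_int (degree_form ps xs * int_dot ys ys + degree_form ps ys * int_dot xs xs)"
    unfolding of_int_le_iff using cert by simp_all
  then have "8 \<le> ?Qx / X + ?Qy / Y" "4 \<le> ?Dx / X + ?Dy / Y"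
    using pos by (simp_all add: field_simps X_def Y_def)
  \<comment> \<open>The left side equals 4 for every \<alpha>, and both weights are
    nonnegative.\<close>
  then have "(1 - \<alpha>) * 8 + (2 * \<alpha> - 1) * 4
    \<le> (1 - \<alpha>) * (?Qx / X + ?Qy / Y) + (2 * \<alpha> - 1) * (?Dx / X + ?Dy / Y)"
    using \<alpha> by (intro add_mono mult_left_mono) auto
  also have "\<dots> = graph_form \<alpha> ?m (tree_adj ps) ?x / dot ?m ?x ?x
      + graph_form \<alpha> ?m (tree_adj ps) ?y / dot ?m ?y ?y"
    by (simp only: dots graph_form_tree_int[of ps \<alpha> xs, OF par] graph_form_tree_int[of ps \<alpha> ys, OF par])
      (simp add: add_divide_distrib diff_divide_distrib algebra_simps)
  also have "\<dots> \<le> S2 (A_alpha \<alpha> ?m (tree_adj ps))"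
    using \<open>ps \<noteq> []\<close> cert pos
    by (intro graph_form_pair_le_S2 simple_graph_tree_adj) (auto simp: dots Suc_le_eq)
  also have "\<dots> \<le> S2 (A_alpha \<alpha> n E)"
    using emb \<open>ps \<noteq> []\<close> unfolding contains_tree_def
    by (intro S2_mono_embeds simple_graph_tree_adj G \<alpha>) (auto simp: Suc_le_eq)
  finally show ?thesis by (simp add: algebra_simps)
qed

lemma embedding_check_sound:
  assumes "embedding_check qs ps g" "contains_tree n E ps"
  shows "contains_tree n E qs"
proof -
  have g: "length g = Suc (length qs)" "distinct g" "\<And>i. i \<in> set g \<Longrightarrow> i \<le> length ps"
    and adj: "\<And>k. k < length qs \<Longrightarrow> tree_adj ps (g ! Suc k) (g ! (qs ! k))"
    using assms(1) by (auto simp: embedding_check_def list_all_iff)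
  have commute: "tree_adj ps i j \<Longrightarrow> tree_adj ps j i" for i j by (auto simp: tree_adj_def)
  have "tree_adj ps (g ! i) (g ! j)" if "i < Suc (length qs)" "j < i" "qs ! (i - 1) = j" for i j
    using that adj[of "i - 1"] by (cases i) auto
  then have "embeds (Suc (length qs)) (tree_adj qs) (Suc (length ps)) (tree_adj ps)"
    using g by (intro embedsI[of "(!) g"])
      (auto simp: inj_on_nth less_Suc_eq_le tree_adj_def[of qs] intro: commute)
  then show ?thesis
    using assms(2) embeds_trans unfolding contains_tree_def by blast
qed

text \<open>These trees have 7 to 11 vertices. In each entry the first vector is nonnegative, like a
  leading eigenvector, and the second changes sign. The star with six leaves is tight at \<alpha> =
  1/2: the two largest eigenvalues of its signless Laplacian are 7 and 1, with sum exactly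
  8.\<close>

definition certified_trees :: "(nat list \<times> int list \<times> int list) list" where
  "certified_trees = [
    ([0, 0, 0, 0, 0, 0], [6, 1, 1, 1, 1, 1, 1], [0, 0, 1, -1, 0, 0, 0]),
    ([0, 0, 0, 0, 0, 1], [4, 1, 1, 1, 1, 1, 0], [0, 1, -1, 0, 0, 0, 1]),
    ([0, 0, 0, 0, 1, 1], [3, 2, 1, 1, 1, 0, 0], [-1, 2, -1, 0, 0, 1, 1]),
    ([0, 0, 0, 0, 1, 5], [3, 1, 1, 1, 1, 0, 0], [-1, 3, 0, 0, 0, 4, 1]),
    ([0, 0, 0, 1, 4, 4], [3, 2, 1, 1, 3, 1, 1], [-2, 0, -1, -1, 2, 1, 1]),
    ([0, 0, 0, 1, 1, 2, 3], [7, 6, 3, 3, 2, 2, 1, 1], [4, -8, 5, 5, -4, -3, 2, 2]),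
    ([0, 0, 0, 1, 1, 2, 4], [3, 3, 1, 1, 1, 1, 0, 0], [2, -2, 2, 1, -2, -1, 1, -1]),
    ([0, 0, 0, 1, 1, 2, 6], [4, 4, 2, 1, 1, 1, 1, 0], [1, -2, 2, 0, -1, -1, 2, 1]),
    ([0, 0, 0, 1, 4, 5, 5], [1, 1, 0, 0, 1, 1, 0, 0], [-3, -1, -1, -1, 1, 3, 1, 1]),
    ([0, 0, 0, 1, 4, 5, 6, 6], [1, 1, 0, 0, 1, 1, 1, 0, 0], [-2, -1, -1, -1, 0, 1, 2, 1, 1]),
    ([0, 0, 0, 1, 2, 3, 4, 7, 8], [6, 3, 3, 3, 2, 1, 1, 1, 0, 0], [-1, 1, -1, -1, 3, -1, 0, 4, 3, 1]),
    ([0, 0, 0, 1, 2, 4, 6, 7, 8], [6, 3, 3, 2, 2, 1, 1, 1, 0, 0], [-2, 1, -1, -1, 3, 0, 4, 4, 3, 1]),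
    ([0, 0, 0, 1, 4, 5, 6, 7, 7], [1, 1, 0, 0, 1, 1, 1, 1, 0, 0], [-2, -1, -1, -1, 0, 0, 1, 2, 1, 1]),
    ([0, 0, 0, 1, 4, 5, 6, 7, 8], [20, 12, 6, 6, 8, 5, 3, 2, 1, 0], [-9, -1, -3, -3, 8, 14, 17, 16, 11, 4]),
    ([0, 0, 0, 1, 2, 3, 4, 5, 7, 8], [22, 11, 11, 10, 6, 6, 3, 3, 3, 1, 1], [0, 4, -4, 0, 6, -6, 0, 5, -5, 2, -2]),
    ([0, 0, 0, 1, 2, 4, 5, 6, 7, 8], [7, 4, 4, 2, 2, 2, 1, 1, 1, 0, 0], [-2, 4, -5, -1, 9, -6, 11, -5, 8, -2, 3])]"

text \<open>The nonpath trees on fewer than 12 vertices that contain no certified tree. The \<open>k\<close>-th item of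
  an entry concerns the tree obtained by attaching a leaf to vertex \<open>k\<close>: it gives a tree of one of
  the two lists together with an embedding of it.\<close>

definition small_trees :: "(nat list \<times> (nat list \<times> nat list) list) list" where
  "small_trees = [
    ([0, 0, 0], [
      ([0, 0, 0, 0], [0, 1, 2, 3, 4]), ([0, 0, 0, 1], [0, 1, 2, 3, 4]),
      ([0, 0, 0, 1], [0, 2, 1, 3, 4]), ([0, 0, 0, 1], [0, 3, 1, 2, 4])]),
    ([0, 0, 0, 0], [
      ([0, 0, 0, 0, 0], [0, 1, 2, 3, 4, 5]), ([0, 0, 0, 0, 1], [0, 1, 2, 3, 4, 5]),
      ([0, 0, 0, 0, 1], [0, 2, 1, 3, 4, 5]), ([0, 0, 0, 0, 1], [0, 3, 1, 2, 4, 5]),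
      ([0, 0, 0, 0, 1], [0, 4, 1, 2, 3, 5])]),
    ([0, 0, 0, 1], [
      ([0, 0, 0, 0, 1], [0, 1, 2, 3, 5, 4]), ([0, 0, 0, 1, 1], [0, 1, 2, 3, 4, 5]),
      ([0, 0, 0, 1, 2], [0, 1, 2, 3, 4, 5]), ([0, 0, 0, 1, 2], [0, 1, 3, 2, 4, 5]),
      ([0, 0, 0, 1, 4], [0, 1, 2, 3, 4, 5])]),
    ([0, 0, 0, 0, 0], [
      ([0, 0, 0, 0, 0, 0], [0, 1, 2, 3, 4, 5, 6]), ([0, 0, 0, 0, 0, 1], [0, 1, 2, 3, 4, 5, 6]),
      ([0, 0, 0, 0, 0, 1], [0, 2, 1, 3, 4, 5, 6]), ([0, 0, 0, 0, 0, 1], [0, 3, 1, 2, 4, 5, 6]),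
      ([0, 0, 0, 0, 0, 1], [0, 4, 1, 2, 3, 5, 6]), ([0, 0, 0, 0, 0, 1], [0, 5, 1, 2, 3, 4, 6])]),
    ([0, 0, 0, 0, 1], [
      ([0, 0, 0, 0, 0, 1], [0, 1, 2, 3, 4, 6, 5]), ([0, 0, 0, 0, 1, 1], [0, 1, 2, 3, 4, 5, 6]),
      ([0, 0, 0, 0, 1, 2], [0, 1, 2, 3, 4, 5, 6]), ([0, 0, 0, 0, 1, 2], [0, 1, 3, 2, 4, 5, 6]),
      ([0, 0, 0, 0, 1, 2], [0, 1, 4, 2, 3, 5, 6]), ([0, 0, 0, 0, 1, 5], [0, 1, 2, 3, 4, 5, 6])]),
    ([0, 0, 0, 1, 1], [
      ([0, 0, 0, 0, 1, 1], [0, 1, 2, 3, 6, 4, 5]), ([0, 0, 0, 0, 1, 1], [1, 0, 4, 5, 6, 2, 3]),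
      ([0, 0, 0, 1, 1, 2], [0, 1, 2, 3, 4, 5, 6]), ([0, 0, 0, 1, 1, 2], [0, 1, 3, 2, 4, 5, 6]),
      ([0, 0, 0, 1, 1, 2], [1, 0, 4, 5, 2, 3, 6]), ([0, 0, 0, 1, 1, 2], [1, 0, 5, 4, 2, 3, 6])]),
    ([0, 0, 0, 1, 2], [
      ([0, 0, 0, 0, 1, 2], [0, 1, 2, 3, 6, 4, 5]), ([0, 0, 0, 1, 1, 2], [0, 1, 2, 3, 4, 6, 5]),
      ([0, 0, 0, 1, 1, 2], [0, 2, 1, 3, 5, 6, 4]), ([0, 0, 0, 1, 2, 3], [0, 1, 2, 3, 4, 5, 6]),
      ([0, 0, 0, 1, 2, 4], [0, 1, 2, 3, 4, 5, 6]), ([0, 0, 0, 1, 2, 4], [0, 2, 1, 3, 5, 4, 6])]),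
    ([0, 0, 0, 1, 4], [
      ([0, 0, 0, 0, 1, 5], [0, 1, 2, 3, 6, 4, 5]), ([0, 0, 0, 1, 1, 2], [1, 0, 4, 6, 2, 3, 5]),
      ([0, 0, 0, 1, 2, 4], [0, 1, 2, 3, 4, 6, 5]), ([0, 0, 0, 1, 2, 4], [0, 1, 3, 2, 4, 6, 5]),
      ([0, 0, 0, 1, 4, 4], [0, 1, 2, 3, 4, 5, 6]), ([0, 0, 0, 1, 4, 5], [0, 1, 2, 3, 4, 5, 6])]),
    ([0, 0, 0, 0, 1, 2], [
      ([0, 0, 0, 0, 0, 1], [0, 1, 2, 3, 4, 7, 5]), ([0, 0, 0, 0, 1, 1], [0, 1, 2, 3, 4, 5, 7]),
      ([0, 0, 0, 0, 1, 1], [0, 2, 1, 3, 4, 6, 7]),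
      ([0, 0, 0, 0, 1, 2, 3], [0, 1, 2, 3, 4, 5, 6, 7]),
      ([0, 0, 0, 0, 1, 2, 3], [0, 1, 2, 4, 3, 5, 6, 7]),
      ([0, 0, 0, 0, 1, 5], [0, 1, 2, 3, 4, 5, 7]), ([0, 0, 0, 0, 1, 5], [0, 2, 1, 3, 4, 6, 7])]),
    ([0, 0, 0, 1, 1, 2], [
      ([0, 0, 0, 0, 1, 1], [0, 1, 2, 3, 7, 4, 5]), ([0, 0, 0, 0, 1, 1], [1, 0, 4, 5, 7, 2, 3]),
      ([0, 0, 0, 1, 4, 4], [1, 0, 4, 5, 2, 6, 7]),
      ([0, 0, 0, 1, 1, 2, 3], [0, 1, 2, 3, 4, 5, 6, 7]),
      ([0, 0, 0, 1, 1, 2, 4], [0, 1, 2, 3, 4, 5, 6, 7]),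
      ([0, 0, 0, 1, 1, 2, 4], [0, 1, 2, 3, 5, 4, 6, 7]),
      ([0, 0, 0, 1, 1, 2, 6], [0, 1, 2, 3, 4, 5, 6, 7])]),
    ([0, 0, 0, 1, 2, 3], [
      ([0, 0, 0, 0, 1, 2, 3], [0, 1, 2, 3, 7, 4, 5, 6]),
      ([0, 0, 0, 1, 1, 2, 3], [0, 1, 2, 3, 4, 7, 5, 6]),
      ([0, 0, 0, 1, 1, 2, 3], [0, 2, 1, 3, 5, 7, 4, 6]),
      ([0, 0, 0, 1, 1, 2, 3], [0, 3, 1, 2, 6, 7, 4, 5]),
      ([0, 0, 0, 1, 2, 3, 4], [0, 1, 2, 3, 4, 5, 6, 7]),
      ([0, 0, 0, 1, 2, 3, 4], [0, 2, 1, 3, 5, 4, 6, 7]),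
      ([0, 0, 0, 1, 2, 3, 4], [0, 3, 1, 2, 6, 4, 5, 7])]),
    ([0, 0, 0, 1, 2, 4], [
      ([0, 0, 0, 0, 1, 5], [0, 1, 2, 3, 7, 4, 6]),
      ([0, 0, 0, 1, 1, 2, 4], [0, 1, 2, 3, 4, 7, 5, 6]),
      ([0, 0, 0, 1, 1, 2, 6], [0, 2, 1, 3, 5, 7, 4, 6]),
      ([0, 0, 0, 1, 2, 3, 4], [0, 1, 2, 3, 4, 5, 7, 6]),
      ([0, 0, 0, 1, 4, 4], [0, 1, 2, 3, 4, 6, 7]),
      ([0, 0, 0, 1, 2, 4, 5], [0, 1, 2, 3, 4, 5, 6, 7]),
      ([0, 0, 0, 1, 2, 4, 6], [0, 1, 2, 3, 4, 5, 6, 7])]),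
    ([0, 0, 0, 1, 4, 5], [
      ([0, 0, 0, 0, 1, 5], [0, 1, 2, 3, 7, 4, 5]),
      ([0, 0, 0, 1, 1, 2, 6], [1, 0, 4, 7, 2, 3, 5, 6]),
      ([0, 0, 0, 1, 2, 4, 6], [0, 1, 2, 3, 4, 7, 5, 6]),
      ([0, 0, 0, 1, 2, 4, 6], [0, 1, 3, 2, 4, 7, 5, 6]),
      ([0, 0, 0, 1, 4, 4], [0, 1, 2, 3, 4, 5, 7]),
      ([0, 0, 0, 1, 4, 5, 5], [0, 1, 2, 3, 4, 5, 6, 7]),
      ([0, 0, 0, 1, 4, 5, 6], [0, 1, 2, 3, 4, 5, 6, 7])]),
    ([0, 0, 0, 0, 1, 2, 3], [
      ([0, 0, 0, 0, 0, 1], [0, 1, 2, 3, 4, 8, 5]), ([0, 0, 0, 0, 1, 1], [0, 1, 2, 3, 4, 5, 8]),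
      ([0, 0, 0, 0, 1, 1], [0, 2, 1, 3, 4, 6, 8]), ([0, 0, 0, 0, 1, 1], [0, 3, 1, 2, 4, 7, 8]),
      ([0, 0, 0, 0, 1, 2, 3, 4], [0, 1, 2, 3, 4, 5, 6, 7, 8]),
      ([0, 0, 0, 0, 1, 5], [0, 1, 2, 3, 4, 5, 8]), ([0, 0, 0, 0, 1, 5], [0, 2, 1, 3, 4, 6, 8]),
      ([0, 0, 0, 0, 1, 5], [0, 3, 1, 2, 4, 7, 8])]),
    ([0, 0, 0, 1, 2, 3, 4], [
      ([0, 0, 0, 0, 1, 5], [0, 1, 2, 3, 8, 4, 7]),
      ([0, 0, 0, 1, 1, 2, 3], [0, 1, 2, 3, 4, 8, 5, 6]),
      ([0, 0, 0, 1, 1, 2, 3], [0, 2, 1, 3, 5, 8, 4, 6]),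
      ([0, 0, 0, 1, 1, 2, 3], [0, 3, 1, 2, 6, 8, 4, 5]),
      ([0, 0, 0, 1, 4, 4], [0, 1, 2, 3, 4, 7, 8]),
      ([0, 0, 0, 1, 2, 3, 4, 5], [0, 1, 2, 3, 4, 5, 6, 7, 8]),
      ([0, 0, 0, 1, 2, 3, 4, 5], [0, 1, 3, 2, 4, 6, 5, 7, 8]),
      ([0, 0, 0, 1, 2, 3, 4, 7], [0, 1, 2, 3, 4, 5, 6, 7, 8])]),
    ([0, 0, 0, 1, 2, 4, 5], [
      ([0, 0, 0, 0, 1, 5], [0, 1, 2, 3, 8, 4, 6]),
      ([0, 0, 0, 1, 1, 2, 4], [0, 1, 2, 3, 4, 8, 5, 6]),
      ([0, 0, 0, 1, 1, 2, 4], [0, 2, 1, 3, 5, 8, 4, 7]),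
      ([0, 0, 0, 1, 2, 3, 4, 5], [0, 1, 2, 3, 4, 5, 8, 6, 7]),
      ([0, 0, 0, 1, 4, 4], [0, 1, 2, 3, 4, 6, 8]), ([0, 0, 0, 1, 4, 4], [0, 2, 1, 3, 5, 7, 8]),
      ([0, 0, 0, 1, 2, 4, 5, 6], [0, 1, 2, 3, 4, 5, 6, 7, 8]),
      ([0, 0, 0, 1, 2, 4, 5, 6], [0, 2, 1, 3, 5, 4, 7, 6, 8])]),
    ([0, 0, 0, 1, 2, 4, 6], [
      ([0, 0, 0, 0, 1, 5], [0, 1, 2, 3, 8, 4, 6]),
      ([0, 0, 0, 1, 1, 2, 4], [0, 1, 2, 3, 4, 8, 5, 6]),
      ([0, 0, 0, 1, 1, 2, 6], [0, 2, 1, 3, 5, 8, 4, 6]),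
      ([0, 0, 0, 1, 2, 3, 4, 7], [0, 1, 2, 3, 4, 5, 8, 6, 7]),
      ([0, 0, 0, 1, 4, 4], [0, 1, 2, 3, 4, 6, 8]),
      ([0, 0, 0, 1, 2, 4, 5, 6], [0, 1, 2, 3, 4, 5, 6, 8, 7]),
      ([0, 0, 0, 1, 4, 5, 5], [0, 1, 2, 3, 4, 6, 7, 8]),
      ([0, 0, 0, 1, 2, 4, 6, 7], [0, 1, 2, 3, 4, 5, 6, 7, 8])]),
    ([0, 0, 0, 1, 4, 5, 6], [
      ([0, 0, 0, 0, 1, 5], [0, 1, 2, 3, 8, 4, 5]),
      ([0, 0, 0, 1, 1, 2, 6], [1, 0, 4, 8, 2, 3, 5, 6]),
      ([0, 0, 0, 1, 2, 4, 6, 7], [0, 1, 2, 3, 4, 8, 5, 6, 7]),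
      ([0, 0, 0, 1, 2, 4, 6, 7], [0, 1, 3, 2, 4, 8, 5, 6, 7]),
      ([0, 0, 0, 1, 4, 4], [0, 1, 2, 3, 4, 5, 8]),
      ([0, 0, 0, 1, 4, 5, 5], [0, 1, 2, 3, 4, 5, 6, 8]),
      ([0, 0, 0, 1, 4, 5, 6, 6], [0, 1, 2, 3, 4, 5, 6, 7, 8]),
      ([0, 0, 0, 1, 4, 5, 6, 7], [0, 1, 2, 3, 4, 5, 6, 7, 8])]),
    ([0, 0, 0, 0, 1, 2, 3, 4], [
      ([0, 0, 0, 0, 0, 1], [0, 1, 2, 3, 4, 9, 5]), ([0, 0, 0, 0, 1, 1], [0, 1, 2, 3, 4, 5, 9]),
      ([0, 0, 0, 0, 1, 1], [0, 2, 1, 3, 4, 6, 9]), ([0, 0, 0, 0, 1, 1], [0, 3, 1, 2, 4, 7, 9]),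
      ([0, 0, 0, 0, 1, 1], [0, 4, 1, 2, 3, 8, 9]), ([0, 0, 0, 0, 1, 5], [0, 1, 2, 3, 4, 5, 9]),
      ([0, 0, 0, 0, 1, 5], [0, 2, 1, 3, 4, 6, 9]), ([0, 0, 0, 0, 1, 5], [0, 3, 1, 2, 4, 7, 9]),
      ([0, 0, 0, 0, 1, 5], [0, 4, 1, 2, 3, 8, 9])]),
    ([0, 0, 0, 1, 2, 3, 4, 5], [
      ([0, 0, 0, 0, 1, 5], [0, 1, 2, 3, 9, 4, 7]),
      ([0, 0, 0, 1, 1, 2, 3], [0, 1, 2, 3, 4, 9, 5, 6]),
      ([0, 0, 0, 1, 1, 2, 3], [0, 2, 1, 3, 5, 9, 4, 6]),
      ([0, 0, 0, 1, 1, 2, 3], [0, 3, 1, 2, 6, 9, 4, 5]),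
      ([0, 0, 0, 1, 4, 4], [0, 1, 2, 3, 4, 7, 9]), ([0, 0, 0, 1, 4, 4], [0, 2, 1, 3, 5, 8, 9]),
      ([0, 0, 0, 1, 2, 3, 4, 5, 6], [0, 1, 2, 3, 4, 5, 6, 7, 8, 9]),
      ([0, 0, 0, 1, 2, 3, 4, 5, 7], [0, 1, 2, 3, 4, 5, 6, 7, 8, 9]),
      ([0, 0, 0, 1, 2, 3, 4, 5, 7], [0, 2, 1, 3, 5, 4, 6, 8, 7, 9])]),
    ([0, 0, 0, 1, 2, 3, 4, 7], [
      ([0, 0, 0, 0, 1, 5], [0, 1, 2, 3, 9, 4, 7]),
      ([0, 0, 0, 1, 1, 2, 3], [0, 1, 2, 3, 4, 9, 5, 6]),
      ([0, 0, 0, 1, 1, 2, 3], [0, 2, 1, 3, 5, 9, 4, 6]),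
      ([0, 0, 0, 1, 1, 2, 3], [0, 3, 1, 2, 6, 9, 4, 5]),
      ([0, 0, 0, 1, 4, 4], [0, 1, 2, 3, 4, 7, 9]),
      ([0, 0, 0, 1, 2, 3, 4, 5, 7], [0, 1, 2, 3, 4, 5, 6, 7, 9, 8]),
      ([0, 0, 0, 1, 2, 3, 4, 5, 7], [0, 1, 3, 2, 4, 6, 5, 7, 9, 8]),
      ([0, 0, 0, 1, 4, 5, 5], [0, 1, 2, 3, 4, 7, 8, 9]),
      ([0, 0, 0, 1, 2, 3, 4, 7, 8], [0, 1, 2, 3, 4, 5, 6, 7, 8, 9])]),
    ([0, 0, 0, 1, 2, 4, 5, 6], [
      ([0, 0, 0, 0, 1, 5], [0, 1, 2, 3, 9, 4, 6]),
      ([0, 0, 0, 1, 1, 2, 4], [0, 1, 2, 3, 4, 9, 5, 6]),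
      ([0, 0, 0, 1, 1, 2, 4], [0, 2, 1, 3, 5, 9, 4, 7]),
      ([0, 0, 0, 1, 2, 3, 4, 5, 7], [0, 1, 2, 3, 4, 5, 9, 6, 7, 8]),
      ([0, 0, 0, 1, 4, 4], [0, 1, 2, 3, 4, 6, 9]), ([0, 0, 0, 1, 4, 4], [0, 2, 1, 3, 5, 7, 9]),
      ([0, 0, 0, 1, 4, 5, 5], [0, 1, 2, 3, 4, 6, 8, 9]),
      ([0, 0, 0, 1, 2, 4, 5, 6, 7], [0, 1, 2, 3, 4, 5, 6, 7, 8, 9]),
      ([0, 0, 0, 1, 2, 4, 5, 6, 8], [0, 1, 2, 3, 4, 5, 6, 7, 8, 9])]),
    ([0, 0, 0, 1, 2, 4, 6, 7], [
      ([0, 0, 0, 0, 1, 5], [0, 1, 2, 3, 9, 4, 6]),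
      ([0, 0, 0, 1, 1, 2, 4], [0, 1, 2, 3, 4, 9, 5, 6]),
      ([0, 0, 0, 1, 1, 2, 6], [0, 2, 1, 3, 5, 9, 4, 6]),
      ([0, 0, 0, 1, 2, 3, 4, 7, 8], [0, 1, 2, 3, 4, 5, 9, 6, 7, 8]),
      ([0, 0, 0, 1, 4, 4], [0, 1, 2, 3, 4, 6, 9]),
      ([0, 0, 0, 1, 2, 4, 5, 6, 8], [0, 1, 2, 3, 4, 5, 6, 9, 7, 8]),
      ([0, 0, 0, 1, 4, 5, 5], [0, 1, 2, 3, 4, 6, 7, 9]),
      ([0, 0, 0, 1, 4, 5, 6, 6], [0, 1, 2, 3, 4, 6, 7, 8, 9]),
      ([0, 0, 0, 1, 2, 4, 6, 7, 8], [0, 1, 2, 3, 4, 5, 6, 7, 8, 9])]),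
    ([0, 0, 0, 1, 4, 5, 6, 7], [
      ([0, 0, 0, 0, 1, 5], [0, 1, 2, 3, 9, 4, 5]),
      ([0, 0, 0, 1, 1, 2, 6], [1, 0, 4, 9, 2, 3, 5, 6]),
      ([0, 0, 0, 1, 2, 4, 6, 7, 8], [0, 1, 2, 3, 4, 9, 5, 6, 7, 8]),
      ([0, 0, 0, 1, 2, 4, 6, 7, 8], [0, 1, 3, 2, 4, 9, 5, 6, 7, 8]),
      ([0, 0, 0, 1, 4, 4], [0, 1, 2, 3, 4, 5, 9]),
      ([0, 0, 0, 1, 4, 5, 5], [0, 1, 2, 3, 4, 5, 6, 9]),
      ([0, 0, 0, 1, 4, 5, 6, 6], [0, 1, 2, 3, 4, 5, 6, 7, 9]),
      ([0, 0, 0, 1, 4, 5, 6, 7, 7], [0, 1, 2, 3, 4, 5, 6, 7, 8, 9]),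
      ([0, 0, 0, 1, 4, 5, 6, 7, 8], [0, 1, 2, 3, 4, 5, 6, 7, 8, 9])]),
    ([0, 0, 0, 1, 2, 3, 4, 5, 6], [
      ([0, 0, 0, 0, 1, 5], [0, 1, 2, 3, 10, 4, 7]),
      ([0, 0, 0, 1, 1, 2, 3], [0, 1, 2, 3, 4, 10, 5, 6]),
      ([0, 0, 0, 1, 1, 2, 3], [0, 2, 1, 3, 5, 10, 4, 6]),
      ([0, 0, 0, 1, 1, 2, 3], [0, 3, 1, 2, 6, 10, 4, 5]),
      ([0, 0, 0, 1, 4, 4], [0, 1, 2, 3, 4, 7, 10]), ([0, 0, 0, 1, 4, 4], [0, 2, 1, 3, 5, 8, 10]),
      ([0, 0, 0, 1, 4, 4], [0, 3, 1, 2, 6, 9, 10]),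
      ([0, 0, 0, 1, 2, 3, 4, 5, 6, 7], [0, 1, 2, 3, 4, 5, 6, 7, 8, 9, 10]),
      ([0, 0, 0, 1, 2, 3, 4, 5, 6, 7], [0, 2, 1, 3, 5, 4, 6, 8, 7, 9, 10]),
      ([0, 0, 0, 1, 2, 3, 4, 5, 6, 7], [0, 3, 1, 2, 6, 4, 5, 9, 7, 8, 10])]),
    ([0, 0, 0, 1, 2, 3, 4, 5, 7], [
      ([0, 0, 0, 0, 1, 5], [0, 1, 2, 3, 10, 4, 7]),
      ([0, 0, 0, 1, 1, 2, 3], [0, 1, 2, 3, 4, 10, 5, 6]),
      ([0, 0, 0, 1, 1, 2, 3], [0, 2, 1, 3, 5, 10, 4, 6]),
      ([0, 0, 0, 1, 1, 2, 3], [0, 3, 1, 2, 6, 10, 4, 5]),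
      ([0, 0, 0, 1, 4, 4], [0, 1, 2, 3, 4, 7, 10]), ([0, 0, 0, 1, 4, 4], [0, 2, 1, 3, 5, 8, 10]),
      ([0, 0, 0, 1, 2, 3, 4, 5, 6, 7], [0, 1, 2, 3, 4, 5, 6, 7, 8, 10, 9]),
      ([0, 0, 0, 1, 4, 5, 5], [0, 1, 2, 3, 4, 7, 9, 10]),
      ([0, 0, 0, 1, 2, 3, 4, 5, 7, 8], [0, 1, 2, 3, 4, 5, 6, 7, 8, 9, 10]),
      ([0, 0, 0, 1, 2, 3, 4, 7, 8], [0, 1, 2, 3, 4, 5, 6, 7, 9, 10])]),
    ([0, 0, 0, 1, 2, 4, 5, 6, 7], [
      ([0, 0, 0, 0, 1, 5], [0, 1, 2, 3, 10, 4, 6]),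
      ([0, 0, 0, 1, 1, 2, 4], [0, 1, 2, 3, 4, 10, 5, 6]),
      ([0, 0, 0, 1, 1, 2, 4], [0, 2, 1, 3, 5, 10, 4, 7]),
      ([0, 0, 0, 1, 2, 3, 4, 5, 7, 8], [0, 1, 2, 3, 4, 5, 10, 6, 7, 8, 9]),
      ([0, 0, 0, 1, 4, 4], [0, 1, 2, 3, 4, 6, 10]), ([0, 0, 0, 1, 4, 4], [0, 2, 1, 3, 5, 7, 10]),
      ([0, 0, 0, 1, 4, 5, 5], [0, 1, 2, 3, 4, 6, 8, 10]),
      ([0, 0, 0, 1, 4, 5, 5], [0, 2, 1, 3, 5, 7, 9, 10]),
      ([0, 0, 0, 1, 2, 4, 5, 6, 7, 8], [0, 1, 2, 3, 4, 5, 6, 7, 8, 9, 10]),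
      ([0, 0, 0, 1, 2, 4, 5, 6, 7, 8], [0, 2, 1, 3, 5, 4, 7, 6, 9, 8, 10])]),
    ([0, 0, 0, 1, 2, 4, 5, 6, 8], [
      ([0, 0, 0, 0, 1, 5], [0, 1, 2, 3, 10, 4, 6]),
      ([0, 0, 0, 1, 1, 2, 4], [0, 1, 2, 3, 4, 10, 5, 6]),
      ([0, 0, 0, 1, 1, 2, 4], [0, 2, 1, 3, 5, 10, 4, 7]),
      ([0, 0, 0, 1, 2, 3, 4, 7, 8], [0, 1, 2, 3, 4, 5, 10, 6, 8, 9]),
      ([0, 0, 0, 1, 4, 4], [0, 1, 2, 3, 4, 6, 10]), ([0, 0, 0, 1, 4, 4], [0, 2, 1, 3, 5, 7, 10]),
      ([0, 0, 0, 1, 4, 5, 5], [0, 1, 2, 3, 4, 6, 8, 10]),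
      ([0, 0, 0, 1, 2, 4, 5, 6, 7, 8], [0, 1, 2, 3, 4, 5, 6, 7, 8, 10, 9]),
      ([0, 0, 0, 1, 4, 5, 6, 6], [0, 1, 2, 3, 4, 6, 8, 9, 10]),
      ([0, 0, 0, 1, 2, 4, 6, 7, 8], [0, 1, 2, 3, 4, 5, 6, 8, 9, 10])]),
    ([0, 0, 0, 1, 2, 3, 4, 5, 6, 7], [
      ([0, 0, 0, 0, 1, 5], [0, 1, 2, 3, 11, 4, 7]),
      ([0, 0, 0, 1, 1, 2, 3], [0, 1, 2, 3, 4, 11, 5, 6]),
      ([0, 0, 0, 1, 1, 2, 3], [0, 2, 1, 3, 5, 11, 4, 6]),
      ([0, 0, 0, 1, 1, 2, 3], [0, 3, 1, 2, 6, 11, 4, 5]),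
      ([0, 0, 0, 1, 4, 4], [0, 1, 2, 3, 4, 7, 11]), ([0, 0, 0, 1, 4, 4], [0, 2, 1, 3, 5, 8, 11]),
      ([0, 0, 0, 1, 4, 4], [0, 3, 1, 2, 6, 9, 11]),
      ([0, 0, 0, 1, 4, 5, 5], [0, 1, 2, 3, 4, 7, 10, 11]),
      ([0, 0, 0, 1, 2, 3, 4, 5, 7, 8], [0, 1, 2, 3, 4, 5, 6, 7, 8, 10, 11]),
      ([0, 0, 0, 1, 2, 3, 4, 5, 7, 8], [0, 1, 3, 2, 4, 6, 5, 7, 9, 10, 11]),
      ([0, 0, 0, 1, 2, 3, 4, 7, 8], [0, 1, 2, 3, 4, 5, 6, 7, 10, 11])])]"

section \<open>Exhausting the growth of the claw\<close>

text \<open>A leaf extension either contains a certified tree or is, up to renumbering, a table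
  entry with one more vertex; the strict growth in length makes the search end. The bound 10 leaves
  a vertex to add when \<open>n\<close> is at least 12.\<close>

fun extensions_covered :: "nat list \<times> (nat list \<times> nat list) list \<Rightarrow> bool" where
  "extensions_covered (ps, cs) \<longleftrightarrow> length ps \<le> 10 \<and> length cs = Suc (length ps) \<and>
    list_all (\<lambda>k. case cs ! k of (qs, g) \<Rightarrow> embedding_check qs (ps @ [k]) g \<and>
      (qs \<in> set (map fst certified_trees) \<or>
       length ps < length qs \<and> qs \<in> set (map fst small_trees))) [0..<length cs]"

lemma certified_trees_S2_certificate: "list_all S2_certificate certified_trees"
  by code_simp

lemma small_trees_extensions_covered: "list_all extensions_covered small_trees"
  by code_simp

text \<open>Certified trees aside, the table is closed under adding leaves, so a contained entry can
  be enlarged until a certified tree appears.\<close>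

lemma small_tree_imp_certified_tree:
  assumes G: "simple_graph n E" "graph_connected n E" "n \<ge> 12"
    and "ps \<in> fst ` set small_trees" "contains_tree n E ps"
  shows "\<exists>qs\<in>fst ` set certified_trees. contains_tree n E qs"
  using assms(4,5)
\<comment> \<open>Lists in the table have length at most 10, so the measure is positive and a longer
  list strictly lowers it despite truncated subtraction.\<close>
proof (induction "11 - length ps" arbitrary: ps rule: less_induct)
  case less
  then obtain cs where cs: "(ps, cs) \<in> set small_trees" by auto
  then have cov: "extensions_covered (ps, cs)"
    using small_trees_extensions_covered unfolding list_all_iff by blast
  then have "Suc (length ps) < n" using G(3) by simp
  then obtain k where k: "k \<le> length ps" "contains_tree n E (ps @ [k])"
    using contains_tree_extend[OF G(1,2) less.prems(2)] by blast
  obtain qs g where "cs ! k = (qs, g)" by fastforce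
  then have check: "embedding_check qs (ps @ [k]) g" and
    qs: "qs \<in> fst ` set certified_trees \<or> length ps < length qs \<and> qs \<in> fst ` set small_trees"
    using cov k(1) by (auto simp: list_all_iff less_Suc_eq_le intro: rev_image_eqI dest!: bspec[of _ _ k])
  have "contains_tree n E qs" by (rule embedding_check_sound[OF check k(2)])
  moreover have "length ps \<le> 10" using cov by simp
  then have "qs \<in> fst ` set certified_trees \<or> 11 - length qs < 11 - length ps \<and> qs \<in> fst ` set small_trees"
    using qs by linarith
  ultimately show ?case using less.hyps[of qs] by blast
qed

lemma claw_imp_S2_ge_4:
  assumes G: "simple_graph n E" "graph_connected n E" "n \<ge> 12" and \<alpha>: "1/2 \<le> \<alpha>" "\<alpha> < 1"
    and claw: "contains_tree n E [0, 0, 0]"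
  shows "4 \<le> S2 (A_alpha \<alpha> n E)"
proof -
  have "[0, 0, 0] \<in> fst ` set small_trees" by (simp add: small_trees_def)
  then obtain ps xs ys where ps: "(ps, xs, ys) \<in> set certified_trees" "contains_tree n E ps"
    using small_tree_imp_certified_tree[OF G _ claw] by auto
  moreover have "ps \<noteq> []" using ps(1) by (auto simp: certified_trees_def)
  moreover have "S2_certificate (ps, xs, ys)"
    using certified_trees_S2_certificate ps(1) unfolding list_all_iff by blast
  ultimately show ?thesis using S2_certificate_sound G(1) \<alpha> by blast
qed

theorem theorem5p5:
  fixes n :: nat and E :: "nat \<Rightarrow> nat \<Rightarrow> bool" and \<alpha> :: real
  assumes "simple_graph n E" and "graph_connected n E" and "n \<ge> 12"
    and "1/2 \<le> \<alpha>" and "\<alpha> < 1"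
  shows "S2 (A_alpha \<alpha> n E) \<ge> S2 (A_alpha \<alpha> n path_adj)
     \<and> (S2 (A_alpha \<alpha> n E) = S2 (A_alpha \<alpha> n path_adj) \<longleftrightarrow> graph_iso n E path_adj)"
proof -
  have n: "n \<ge> 2" "n \<ge> 1" using assms(3) by simp_all
  have "S2 (A_alpha \<alpha> n E) = S2 (A_alpha \<alpha> n path_adj)" if "graph_iso n E path_adj"
    using graph_iso_imp_embeds[OF that] S2_mono_embeds assms(1,4,5) simple_graph_path n(1)
    by (metis antisym)
  \<comment> \<open>A strict alternative to isomorphism gives both the inequality and the only-if
    part of the equality case.\<close>
  moreover have "graph_iso n E path_adj \<or> S2 (A_alpha \<alpha> n path_adj) < S2 (A_alpha \<alpha> n E)"
    using hamiltonian_path_or_claw[OF assms(1,2) n(2)]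
  proof
    assume "embeds n path_adj n E"
    then show ?thesis by (rule graph_iso_path_or_S2_less[OF assms(1) n(1) assms(4,5)])
  next
    assume "contains_tree n E [0, 0, 0]"
    then have "4 \<le> S2 (A_alpha \<alpha> n E)" by (rule claw_imp_S2_ge_4[OF assms])
    then show ?thesis using S2_path_less[OF n(1) assms(5)] by simp
  qed
  ultimately show ?thesis by force
qed

end
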